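(* Let $k_n=k_n(x)$ be a (smooth) covariant vector field on $M$, let $$N^k_n=-l^k\,\frac{\partial F}{\partial x^n}-F\,m^k\left(\frac{\partial\theta}{\partial x^n}-k_n\right),\qquad N^k{}_{nmi}=\frac{\partial^2N^k_n}{\partial y^m\,\partial y^i},\qquad d_n=\frac{\partial}{\partial x^n}+N^k_n\frac{\partial}{\partial y^k}.$$ Then $$N^k{}_{nmi}=-\frac1F\,m^km_mm_i\,d_nI ,$$ where $I$ is the main scalar; equivalently, where $I\ne0$, $N^k{}_{nmi}=-\frac1F A^k{}_{mi}\,d_n\ln|I|$.
   Context: $M$ is a 2-dimensional $C^\infty$ manifold; the consideration is local, in coordinates $x^1,x^2$ with induced fibre coordinates $y^1,y^2$ (no orientation-reversing changes). $F=F(x,y)$ is a Finsler metric function (positive, positively homogeneous of degree 1 in $y$, sufficiently smooth for $y\ne0$, with positive definite metric tensor), considered on an open conic region of nonzero tangent vectors. Notation: $l^k=y^k/F$, $y_k=F\,\partial F/\partial y^k$, $l_k=\partial F/\partial y^k=y_k/F$, $g_{ij}=\partial y_i/\partial y^j$, $g^{ij}$ its inverse. With $\gamma_{11}=\gamma_{22}=0$, $\gamma_{12}=-\gamma_{21}=1$, put $\epsilon_{ik}=\sqrt{\det(g_{mn})}\,\gamma_{ik}$, $m_i=-\epsilon_{ik}l^k$, $m^i=g^{ij}m_j$; then $g_{ij}=l_il_j+m_im_j$. The Cartan tensor is $C_{ijk}=\frac12\partial g_{ij}/\partial y^k$, $A_{ijk}=FC_{ijk}$, $A^k{}_{mi}=g^{kj}A_{jmi}$,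 and the main scalar $I=I(x,y)$ is defined by $A_{ijk}=I\,m_im_jm_k$. The angle function $\theta=\theta(x,y)$ is a (smooth) function, positively homogeneous of degree zero in $y$, satisfying $F\,\partial\theta/\partial y^n=m_n$ on the region considered. Repeated indices (running over $1,2$) are summed. *)

theory Defs
  imports "HOL-Analysis.Analysis"
begin

text \<open>
  Everything is written in one coordinate chart: points of the base are \<open>x :: real^2\<close>, tangent
  vectors are \<open>y :: real^2\<close>, and scalar functions on (a region of) the tangent bundle are curried
  functions of \<open>x\<close> and \<open>y\<close>. Tensor indices have the two-element type \<open>2\<close>, so that a sum over an index
  without bounds is the summation convention. In names, \<open>dn\<close> and \<open>up\<close> stand for lower and upper
  indices.
\<close>

type_synonym tfun = "real^2 \<Rightarrow> real^2 \<Rightarrow> real"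

definition dx :: "2 \<Rightarrow> tfun \<Rightarrow> tfun" where
  "dx n f x y = deriv (\<lambda>t. f (x + t *\<^sub>R axis n 1) y) 0"

definition dy :: "2 \<Rightarrow> tfun \<Rightarrow> tfun" where
  "dy n f x y = deriv (\<lambda>t. f x (y + t *\<^sub>R axis n 1)) 0"

text \<open>The class \<open>C\<^sup>p\<close> on a set; meant for open sets.\<close>

primrec Ck_on :: "nat \<Rightarrow> ('a::euclidean_space \<Rightarrow> real) \<Rightarrow> 'a set \<Rightarrow> bool" where
  "Ck_on 0 f S = continuous_on S f"
| "Ck_on (Suc p) f S =
     (f differentiable_on S \<and> (\<forall>b\<in>Basis. Ck_on p (\<lambda>z. frechet_derivative f (at z) b) S))"

definition conic_region :: "(real^2) set \<Rightarrow> ((real^2) \<times> (real^2)) set \<Rightarrow> bool" where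
  "conic_region U W \<longleftrightarrow> open W \<and>
     (\<forall>x y. (x, y) \<in> W \<longrightarrow> x \<in> U \<and> y \<noteq> 0 \<and> (\<forall>t>0. (x, t *\<^sub>R y) \<in> W))"

definition l_up :: "tfun \<Rightarrow> 2 \<Rightarrow> tfun" where
  "l_up F k x y = y $ k / F x y"

definition y_dn :: "tfun \<Rightarrow> 2 \<Rightarrow> tfun" where
  "y_dn F k x y = F x y * dy k F x y"

definition metric :: "tfun \<Rightarrow> real^2 \<Rightarrow> real^2 \<Rightarrow> real^2^2" where
  "metric F x y = (\<chi> i j. dy j (y_dn F i) x y)"

definition g_up :: "tfun \<Rightarrow> 2 \<Rightarrow> 2 \<Rightarrow> tfun" where
  "g_up F i j x y = matrix_inv (metric F x y) $ i $ j"

text \<open>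
  \<open>C\<^sup>4\<close> is what ``sufficiently smooth'' amounts to here: the main scalar involves third derivatives
  of \<open>F\<close>, and it is differentiated once more.
\<close>

definition finsler_metric_on :: "((real^2) \<times> (real^2)) set \<Rightarrow> tfun \<Rightarrow> bool" where
  "finsler_metric_on W F \<longleftrightarrow>
     Ck_on 4 (\<lambda>(x, y). F x y) W \<and>
     (\<forall>(x, y)\<in>W. F x y > 0 \<and>
        (\<forall>t>0. F x (t *\<^sub>R y) = t * F x y) \<and>
        (\<forall>v. v \<noteq> 0 \<longrightarrow> v \<bullet> (metric F x y *v v) > 0))"

definition gam :: "2 \<Rightarrow> 2 \<Rightarrow> real" where
  "gam i k = (if i = 1 \<and> k = 2 then 1 else if i = 2 \<and> k = 1 then - 1 else 0)"

definition eps :: "tfun \<Rightarrow> 2 \<Rightarrow> 2 \<Rightarrow> tfun" where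
  "eps F i k x y = sqrt (det (metric F x y)) * gam i k"

definition m_dn :: "tfun \<Rightarrow> 2 \<Rightarrow> tfun" where
  "m_dn F i x y = - (\<Sum>k\<in>UNIV. eps F i k x y * l_up F k x y)"

definition m_up :: "tfun \<Rightarrow> 2 \<Rightarrow> tfun" where
  "m_up F i x y = (\<Sum>j\<in>UNIV. g_up F i j x y * m_dn F j x y)"

definition C_dn :: "tfun \<Rightarrow> 2 \<Rightarrow> 2 \<Rightarrow> 2 \<Rightarrow> tfun" where
  "C_dn F i j k x y = 1 / 2 * dy k (\<lambda>x y. metric F x y $ i $ j) x y"

definition A_dn :: "tfun \<Rightarrow> 2 \<Rightarrow> 2 \<Rightarrow> 2 \<Rightarrow> tfun" where
  "A_dn F i j k x y = F x y * C_dn F i j k x y"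

definition A_up :: "tfun \<Rightarrow> 2 \<Rightarrow> 2 \<Rightarrow> 2 \<Rightarrow> tfun" where
  "A_up F k m i x y = (\<Sum>j\<in>UNIV. g_up F k j x y * A_dn F j m i x y)"

definition main_scalar :: "tfun \<Rightarrow> tfun" where
  "main_scalar F x y =
     (THE c. \<forall>i j k. A_dn F i j k x y = c * m_dn F i x y * m_dn F j x y * m_dn F k x y)"

text \<open>
  Since \<open>m_dn\<close> contains second derivatives of \<open>F\<close>, \<open>C\<^sup>3\<close> is the regularity of \<open>\<theta>\<close> that matches a
  \<open>C\<^sup>4\<close> metric function.
\<close>

definition angle_function_on :: "((real^2) \<times> (real^2)) set \<Rightarrow> tfun \<Rightarrow> tfun \<Rightarrow> bool" where
  "angle_function_on W F \<theta> \<longleftrightarrow>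
     Ck_on 3 (\<lambda>(x, y). \<theta> x y) W \<and>
     (\<forall>(x, y)\<in>W. (\<forall>t>0. \<theta> x (t *\<^sub>R y) = \<theta> x y) \<and>
        (\<forall>n. F x y * dy n \<theta> x y = m_dn F n x y))"

definition smooth_covector_field_on :: "(real^2) set \<Rightarrow> (2 \<Rightarrow> real^2 \<Rightarrow> real) \<Rightarrow> bool" where
  "smooth_covector_field_on U \<kappa> \<longleftrightarrow> (\<forall>n p. Ck_on p (\<kappa> n) U)"

definition N_coeff :: "tfun \<Rightarrow> tfun \<Rightarrow> (2 \<Rightarrow> real^2 \<Rightarrow> real) \<Rightarrow> 2 \<Rightarrow> 2 \<Rightarrow> tfun" where
  "N_coeff F \<theta> \<kappa> k n x y =
     - l_up F k x y * dx n F x y - F x y * m_up F k x y * (dx n \<theta> x y - \<kappa> n x)"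

definition N_coeff2 ::
  "tfun \<Rightarrow> tfun \<Rightarrow> (2 \<Rightarrow> real^2 \<Rightarrow> real) \<Rightarrow> 2 \<Rightarrow> 2 \<Rightarrow> 2 \<Rightarrow> 2 \<Rightarrow> tfun" where
  "N_coeff2 F \<theta> \<kappa> k n m i x y = dy m (dy i (N_coeff F \<theta> \<kappa> k n)) x y"

definition d_op :: "tfun \<Rightarrow> tfun \<Rightarrow> (2 \<Rightarrow> real^2 \<Rightarrow> real) \<Rightarrow> 2 \<Rightarrow> tfun \<Rightarrow> tfun" where
  "d_op F \<theta> \<kappa> n f x y = dx n f x y + (\<Sum>k\<in>UNIV. N_coeff F \<theta> \<kappa> k n x y * dy k f x y)"

end

theory Submission
  imports Defs
begin

text \<open>
  The pair \<open>(l, m)\<close> is a frame in which every tensor of a two-dimensional Finsler space has scalar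
  components: \<open>g\<^sub>i\<^sub>j = l\<^sub>i l\<^sub>j + m\<^sub>i m\<^sub>j\<close>, and since the Cartan tensor is symmetric and is annihilated by
  \<open>y\<close>, it is a multiple of \<open>m\<^sub>i m\<^sub>j m\<^sub>k\<close>. Both facts come from Euler's relation for \<open>F\<close> and its fibre
  derivatives (lemmas \<open>metric_frame\<close> and \<open>cartan_frame\<close>). Hence the fibre derivatives of the frame
  close up on the frame and on the main scalar alone:
  \<open>F \<partial>\<^sub>j l\<^sub>i = m\<^sub>i m\<^sub>j\<close>, \<open>F \<partial>\<^sub>j l\<^sup>k = m\<^sup>k m\<^sub>j\<close>, \<open>F \<partial>\<^sub>j m\<^sub>i = (I m\<^sub>i - l\<^sub>i) m\<^sub>j\<close>,
  \<open>F \<partial>\<^sub>j m\<^sup>i = - (l\<^sup>i + I m\<^sup>i) m\<^sub>j\<close>.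

  To differentiate \<open>N\<^sup>k\<^sub>n\<close> along the fibre, the fibre derivatives of \<open>\<partial>F/\<partial>x\<^sup>n\<close> and \<open>\<partial>\<theta>/\<partial>x\<^sup>n\<close> are
  rewritten by the symmetry of second derivatives as base derivatives of \<open>l\<^sub>i\<close> and of \<open>m\<^sub>i / F\<close>; this
  is the only way in which \<open>\<theta>\<close> enters. With \<open>P = \<partial>\<theta>/\<partial>x\<^sup>n - k\<^sub>n\<close> the first derivative is
  \<open>- l\<^sup>k \<partial>l\<^sub>i/\<partial>x\<^sup>n - m\<^sup>k \<partial>m\<^sub>i/\<partial>x\<^sup>n + P (l\<^sup>k m\<^sub>i - m\<^sup>k l\<^sub>i + I m\<^sup>k m\<^sub>i)\<close> (lemma \<open>dy_N\<close>). In the second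
  derivative all base derivatives of the frame cancel, because \<open>\<partial>P/\<partial>y\<^sup>m = \<partial>(m\<^sub>m/F)/\<partial>x\<^sup>n\<close>, and so does
  the derivative of the frame factors in the bracket. Only derivatives of \<open>I\<close> survive:
  \<open>- m\<^sup>k m\<^sub>m m\<^sub>i (\<partial>I/\<partial>x\<^sup>n) / F + P (\<partial>I/\<partial>y\<^sup>m) m\<^sup>k m\<^sub>i\<close> (lemma \<open>dy_dy_N\<close>). As \<open>I\<close> is homogeneous of degree
  zero, \<open>\<partial>I/\<partial>y\<^sup>m\<close> is a multiple of \<open>m\<^sub>m\<close>, and the two terms combine to \<open>d\<^sub>n I\<close>.
\<close>

section \<open>Calculus of \<open>C\<^sup>p\<close> functions\<close>

lemma has_derivative_along_line:
  fixes f :: "'a::euclidean_space \<Rightarrow> real"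
  assumes "f differentiable (at (z + t *\<^sub>R b))"
  shows "((\<lambda>t. f (z + t *\<^sub>R b)) has_real_derivative
           frechet_derivative f (at (z + t *\<^sub>R b)) b) (at t)"
proof -
  let ?f' = "frechet_derivative f (at (z + t *\<^sub>R b))"
  have f: "(f has_derivative ?f') (at (z + t *\<^sub>R b))"
    using assms by (simp add: frechet_derivative_works)
  have "((\<lambda>t. z + t *\<^sub>R b) has_derivative (\<lambda>s. s *\<^sub>R b)) (at t)"
    by (auto intro!: derivative_eq_intros)
  from diff_chain_at[OF this f] have "((\<lambda>t. f (z + t *\<^sub>R b)) has_derivative (\<lambda>s. ?f' (s *\<^sub>R b))) (at t)"
    by (simp add: o_def)
  moreover have "?f' (s *\<^sub>R b) = ?f' b * s" for s
    using linear_frechet_derivative[OF assms] by (simp add: linear_scale)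
  ultimately show ?thesis
    by (simp add: has_field_derivative_def mult_commute_abs)
qed

text \<open>
  The mean value theorem, used first in direction \<open>a\<close> and then in direction \<open>b\<close>. The left side of the
  conclusion is symmetric in \<open>a\<close> and \<open>b\<close>, which is what makes mixed derivatives agree.
\<close>

lemma second_difference_mean_value:
  fixes f :: "'a::euclidean_space \<Rightarrow> real"
  defines "D \<equiv> \<lambda>b f z. frechet_derivative f (at z) b"
  assumes "open S" "f differentiable_on S" "D a f differentiable_on S"
    and s: "s > 0" "cball z (s * (norm a + norm b)) \<subseteq> S"
  obtains p where "p \<in> cball z (s * (norm a + norm b))"
    "f (z + s *\<^sub>R a + s *\<^sub>R b) - f (z + s *\<^sub>R a) - f (z + s *\<^sub>R b) + f z = s\<^sup>2 * D b (D a f) p"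
proof -
  have in_ball: "z + t *\<^sub>R a + u *\<^sub>R b \<in> cball z (s * (norm a + norm b))"
    if "0 \<le> t" "t \<le> s" "0 \<le> u" "u \<le> s" for t u
  proof -
    have "norm (t *\<^sub>R a + u *\<^sub>R b) \<le> t * norm a + u * norm b"
      using norm_triangle_ineq[of "t *\<^sub>R a" "u *\<^sub>R b"] that by simp
    also have "\<dots> \<le> s * (norm a + norm b)"
      using that by (simp add: distrib_left add_mono mult_right_mono)
    finally have "dist (z + (t *\<^sub>R a + u *\<^sub>R b)) z \<le> s * (norm a + norm b)"
      by (simp add: dist_norm)
    then show ?thesis
      by (simp only: mem_cball dist_commute[of z] add.assoc)
  qed
  have diff: "g differentiable (at (z + t *\<^sub>R a + u *\<^sub>R b))"
    if "g differentiable_on S" "0 \<le> t" "t \<le> s" "0 \<le> u" "u \<le> s" for g :: "'a \<Rightarrow> real" and t u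
    using subsetD[OF s(2) in_ball[of t u]] that \<open>open S\<close>
    by (simp add: differentiable_on_eq_differentiable_at)
  define \<phi> where "\<phi> t = f (z + t *\<^sub>R a + s *\<^sub>R b) - f (z + t *\<^sub>R a)" for t
  have \<phi>': "(\<phi> has_real_derivative
      D a f (z + t *\<^sub>R a + s *\<^sub>R b) - D a f (z + t *\<^sub>R a)) (at t)" if "0 \<le> t" "t \<le> s" for t
  proof -
    have "((\<lambda>t. f ((z + s *\<^sub>R b) + t *\<^sub>R a)) has_real_derivative D a f ((z + s *\<^sub>R b) + t *\<^sub>R a)) (at t)"
      unfolding D_def using diff[OF assms(3), of t s] that s
      by (intro has_derivative_along_line) (simp add: algebra_simps)
    moreover have "((\<lambda>t. f (z + t *\<^sub>R a)) has_real_derivative D a f (z + t *\<^sub>R a)) (at t)"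
      unfolding D_def using diff[OF assms(3), of t 0] that s
      by (intro has_derivative_along_line) simp
    ultimately show ?thesis
      unfolding \<phi>_def by (intro DERIV_diff) (simp_all add: algebra_simps)
  qed
  obtain t where t: "0 < t" "t < s"
    "\<phi> s - \<phi> 0 = (s - 0) * (D a f (z + t *\<^sub>R a + s *\<^sub>R b) - D a f (z + t *\<^sub>R a))"
    using MVT2[OF s(1) \<phi>'] by blast
  have u': "((\<lambda>u. D a f (z + t *\<^sub>R a + u *\<^sub>R b)) has_real_derivative
      D b (D a f) (z + t *\<^sub>R a + u *\<^sub>R b)) (at u)" if "0 \<le> u" "u \<le> s" for u
    unfolding D_def using diff[OF assms(4), of t u] that t
    by (intro has_derivative_along_line) (simp add: D_def)
  obtain u where u: "0 < u" "u < s"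
    "D a f (z + t *\<^sub>R a + s *\<^sub>R b) - D a f (z + t *\<^sub>R a + 0 *\<^sub>R b)
      = (s - 0) * D b (D a f) (z + t *\<^sub>R a + u *\<^sub>R b)"
    using MVT2[OF s(1) u'] by blast
  have "f (z + s *\<^sub>R a + s *\<^sub>R b) - f (z + s *\<^sub>R a) - f (z + s *\<^sub>R b) + f z = \<phi> s - \<phi> 0"
    by (simp add: \<phi>_def)
  also have "\<dots> = s * (s * D b (D a f) (z + t *\<^sub>R a + u *\<^sub>R b))"
    using t(3) u(3) by simp
  finally show thesis
    using in_ball[of t u] t(1,2) u(1,2) by (intro that) (simp_all add: power2_eq_square)
qed

text \<open>
  The symmetric second difference of step \<open>s\<close> equals \<open>s\<^sup>2\<close> times either mixed derivative at some point
  near \<open>z\<close>; continuity transfers the agreement to \<open>z\<close> as \<open>s\<close> shrinks.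
\<close>

lemma mixed_derivatives_commute:
  fixes f :: "'a::euclidean_space \<Rightarrow> real"
  defines "D \<equiv> \<lambda>b f z. frechet_derivative f (at z) b"
  assumes "open S" "z \<in> S" "f differentiable_on S"
    "D a f differentiable_on S" "D b f differentiable_on S"
    "continuous_on S (D b (D a f))" "continuous_on S (D a (D b f))"
  shows "D a (D b f) z = D b (D a f) z"
proof -
  have close: "\<forall>\<^sub>F s in at_right 0. \<forall>p\<in>cball z (s * (norm a + norm b)). \<bar>h p - h z\<bar> < e"
    if h: "continuous_on S h" "e > 0" for h :: "'a \<Rightarrow> real" and e
  proof -
    have "isCont h z"
      using h(1) assms(2,3) by (simp add: continuous_on_eq_continuous_at)
    then obtain d where d: "d > 0" "\<And>p. dist p z < d \<Longrightarrow> \<bar>h p - h z\<bar> < e"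
      using h(2) by (auto simp: continuous_at_eps_delta dist_real_def)
    have "((\<lambda>s. s * (norm a + norm b)) \<longlongrightarrow> 0) (at_right 0)"
      by (auto intro!: tendsto_eq_intros)
    then have "\<forall>\<^sub>F s in at_right 0. s * (norm a + norm b) < d"
      using d(1) by (rule order_tendstoD)
    then show ?thesis
      by eventually_elim (use d(2) in \<open>auto simp: dist_commute\<close>)
  qed
  have inside: "\<forall>\<^sub>F s in at_right 0. cball z (s * (norm a + norm b)) \<subseteq> S"
  proof -
    obtain d where d: "d > 0" "ball z d \<subseteq> S"
      using assms(2,3) by (meson openE)
    have "((\<lambda>s. s * (norm a + norm b)) \<longlongrightarrow> 0) (at_right 0)"
      by (auto intro!: tendsto_eq_intros)
    then have "\<forall>\<^sub>F s in at_right 0. s * (norm a + norm b) < d"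
      using d(1) by (rule order_tendstoD)
    then show ?thesis
      by eventually_elim (use d(2) in \<open>auto simp: subset_eq\<close>)
  qed
  have "\<bar>D a (D b f) z - D b (D a f) z\<bar> \<le> e" if "e > 0" for e
  proof -
    have "e / 2 > 0" using that by simp
    note near = eventually_conj[OF eventually_conj[OF close[OF assms(7) this] close[OF assms(8) this]]
        eventually_conj[OF inside eventually_at_right_less[of 0]]]
    obtain s where s: "s > 0" "cball z (s * (norm a + norm b)) \<subseteq> S"
      "\<And>p. p \<in> cball z (s * (norm a + norm b)) \<Longrightarrow> \<bar>D b (D a f) p - D b (D a f) z\<bar> < e / 2"
      "\<And>p. p \<in> cball z (s * (norm a + norm b)) \<Longrightarrow> \<bar>D a (D b f) p - D a (D b f) z\<bar> < e / 2"
      using eventually_happens'[OF trivial_limit_at_right_real near] by blast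
    obtain p where p: "p \<in> cball z (s * (norm a + norm b))"
      "f (z + s *\<^sub>R a + s *\<^sub>R b) - f (z + s *\<^sub>R a) - f (z + s *\<^sub>R b) + f z = s\<^sup>2 * D b (D a f) p"
      using second_difference_mean_value[OF assms(2,4) _ s(1), of a z b] assms(5) s(2)
      unfolding D_def by blast
    obtain q where q: "q \<in> cball z (s * (norm a + norm b))"
      "f (z + s *\<^sub>R b + s *\<^sub>R a) - f (z + s *\<^sub>R b) - f (z + s *\<^sub>R a) + f z = s\<^sup>2 * D a (D b f) q"
      using second_difference_mean_value[OF assms(2,4) _ s(1), of b z a] assms(6) s(2)
      unfolding D_def add.commute[of "norm b"] by blast
    have "s\<^sup>2 * D b (D a f) p = s\<^sup>2 * D a (D b f) q"
      using p(2) q(2) by (simp add: algebra_simps)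
    with s(1) have "D b (D a f) p = D a (D b f) q" by simp
    with s(3)[OF p(1)] s(4)[OF q(1)] show ?thesis by (simp add: abs_if split: if_splits)
  qed
  then have "\<bar>D a (D b f) z - D b (D a f) z\<bar> \<le> 0 + e" if "e > 0" for e
    using that by simp
  then have "\<bar>D a (D b f) z - D b (D a f) z\<bar> \<le> 0"
    by (rule field_le_epsilon)
  then show ?thesis by simp
qed

lemma Ck_on_imp_differentiable:
  "Ck_on (Suc p) f S \<Longrightarrow> open S \<Longrightarrow> z \<in> S \<Longrightarrow> f differentiable (at z)"
  by (simp add: differentiable_on_eq_differentiable_at)

lemma Ck_on_imp_continuous: "Ck_on p f S \<Longrightarrow> continuous_on S f"
  by (cases p) (auto intro: differentiable_imp_continuous_on)

lemma frechet_derivative_cong_open: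
  fixes f g :: "'a::euclidean_space \<Rightarrow> real"
  assumes "open S" "z \<in> S" "\<And>z. z \<in> S \<Longrightarrow> f z = g z"
  shows "frechet_derivative f (at z) = frechet_derivative g (at z)"
proof -
  have "(f has_derivative h) (at z) \<longleftrightarrow> (g has_derivative h) (at z)" for h
    using has_derivative_transform_within_open[of f h z UNIV S g]
      has_derivative_transform_within_open[of g h z UNIV S f] assms by auto
  then show ?thesis by (simp add: frechet_derivative_def)
qed

lemma Ck_on_cong:
  assumes "open S" "\<And>z. z \<in> S \<Longrightarrow> f z = g z"
  shows "Ck_on p f S \<longleftrightarrow> Ck_on p g S"
  using assms(2)
proof (induction p arbitrary: f g)
  case 0
  then show ?case by (simp cong: continuous_on_cong)
next
  case (Suc p)
  have "f differentiable_on S \<longleftrightarrow> g differentiable_on S"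
    unfolding differentiable_on_def differentiable_def
    using has_derivative_transform[of _ S f g] has_derivative_transform[of _ S g f] Suc.prems
    by (intro ball_cong refl ex_cong1) auto
  moreover have "Ck_on p (\<lambda>z. frechet_derivative f (at z) b) S
      \<longleftrightarrow> Ck_on p (\<lambda>z. frechet_derivative g (at z) b) S" for b
    by (rule Suc.IH) (use frechet_derivative_cong_open[OF assms(1) _ Suc.prems] in simp)
  ultimately show ?case by simp
qed

text \<open>
  This form lets the closure properties below exhibit a derivative by the usual rules instead of
  computing with \<open>frechet_derivative\<close>, which is a choice operator.
\<close>

lemma Ck_on_SucI:
  assumes "open S" "\<And>z. z \<in> S \<Longrightarrow> (f has_derivative f' z) (at z)"
    "\<And>b. b \<in> Basis \<Longrightarrow> Ck_on p (\<lambda>z. f' z b) S"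
  shows "Ck_on (Suc p) f S"
proof -
  have "frechet_derivative f (at z) = f' z" if "z \<in> S" for z
    using assms(2)[OF that] frechet_derivative_at by metis
  then have "Ck_on p (\<lambda>z. frechet_derivative f (at z) b) S" if "b \<in> Basis" for b
    using assms(3)[OF that] Ck_on_cong[OF assms(1), of "\<lambda>z. frechet_derivative f (at z) b"] by simp
  then show ?thesis
    using assms(1,2) by (auto simp: differentiable_on_eq_differentiable_at differentiable_def)
qed

lemma Ck_on_SucD:
  assumes "Ck_on (Suc p) f S" "open S"
  shows "z \<in> S \<Longrightarrow> (f has_derivative frechet_derivative f (at z)) (at z)"
    and "b \<in> Basis \<Longrightarrow> Ck_on p (\<lambda>z. frechet_derivative f (at z) b) S"
  subgoal using Ck_on_imp_differentiable[OF assms] by (simp only: frechet_derivative_works)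
  subgoal using assms(1) by simp
  done

lemma Ck_on_Suc_imp: "Ck_on (Suc p) f S \<Longrightarrow> Ck_on p f S"
  by (induction p arbitrary: f) (auto intro: differentiable_imp_continuous_on)

lemma Ck_on_mono: "Ck_on q f S \<Longrightarrow> p \<le> q \<Longrightarrow> Ck_on p f S"
  by (induction q) (auto simp: le_Suc_eq simp del: Ck_on.simps dest: Ck_on_Suc_imp)

lemma Ck_on_const: "open S \<Longrightarrow> Ck_on p (\<lambda>z. c) S"
proof (induction p arbitrary: c)
  case (Suc p)
  show ?case
    by (rule Ck_on_SucI[where f' = "\<lambda>z b. 0"]) (use Suc in auto)
qed simp

lemma Ck_on_linear:
  assumes "open S" "bounded_linear f"
  shows "Ck_on p f S"
proof (cases p)
  case 0
  then show ?thesis using assms(2) by (simp add: linear_continuous_on)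
next
  case (Suc q)
  show ?thesis unfolding Suc
    by (rule Ck_on_SucI[where f' = "\<lambda>z. f"])
      (use assms in \<open>auto intro: bounded_linear_imp_has_derivative Ck_on_const\<close>)
qed

lemma Ck_on_add:
  assumes "open S" "Ck_on p f S" "Ck_on p g S"
  shows "Ck_on p (\<lambda>z. f z + g z) S"
  using assms(2,3)
proof (induction p arbitrary: f g)
  case 0
  then show ?case by (simp add: continuous_on_add)
next
  case (Suc p)
  note f = Ck_on_SucD[OF Suc.prems(1) assms(1)] and g = Ck_on_SucD[OF Suc.prems(2) assms(1)]
  show ?case
    by (rule Ck_on_SucI[OF assms(1) has_derivative_add[OF f(1) g(1)] Suc.IH[OF f(2) g(2)]])
qed

lemma Ck_on_mult:
  assumes "open S" "Ck_on p f S" "Ck_on p g S"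
  shows "Ck_on p (\<lambda>z. f z * g z) S"
  using assms(2,3)
proof (induction p arbitrary: f g)
  case 0
  then show ?case by (simp add: continuous_on_mult)
next
  case (Suc p)
  note f = Ck_on_SucD[OF Suc.prems(1) assms(1)] and g = Ck_on_SucD[OF Suc.prems(2) assms(1)]
  have p: "Ck_on p f S" "Ck_on p g S" using Suc.prems by (simp_all only: Ck_on_Suc_imp)
  show ?case
    by (rule Ck_on_SucI[OF assms(1) has_derivative_mult[OF f(1) g(1)]])
      (simp_all add: Ck_on_add assms(1) Suc.IH f(2) g(2) p)
qed

lemma Ck_on_minus: "open S \<Longrightarrow> Ck_on p f S \<Longrightarrow> Ck_on p (\<lambda>z. - f z) S"
  using Ck_on_mult[OF _ Ck_on_const[of S p "- 1"], of f] by simp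

lemma Ck_on_diff:
  "open S \<Longrightarrow> Ck_on p f S \<Longrightarrow> Ck_on p g S \<Longrightarrow> Ck_on p (\<lambda>z. f z - g z) S"
  using Ck_on_add[OF _ _ Ck_on_minus, of S p f g] by simp

lemma Ck_on_inverse:
  assumes "open S" "Ck_on p f S" "\<And>z. z \<in> S \<Longrightarrow> f z \<noteq> 0"
  shows "Ck_on p (\<lambda>z. inverse (f z)) S"
  using assms(2,3)
proof (induction p)
  case 0
  then show ?case by (simp add: continuous_on_inverse)
next
  case (Suc p)
  note f = Ck_on_SucD[OF Suc.prems(1) assms(1)]
  have "Ck_on p (\<lambda>z. inverse (f z)) S" using Suc Ck_on_Suc_imp by blast
  then show ?case
    by (intro Ck_on_SucI[OF assms(1) Deriv.has_derivative_inverse[OF Suc.prems(2) f(1)]])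
      (auto intro!: Ck_on_minus Ck_on_mult assms(1) f(2))
qed

lemma Ck_on_divide:
  "open S \<Longrightarrow> Ck_on p f S \<Longrightarrow> Ck_on p g S \<Longrightarrow> (\<And>z. z \<in> S \<Longrightarrow> g z \<noteq> 0) \<Longrightarrow> Ck_on p (\<lambda>z. f z / g z) S"
  by (simp add: divide_inverse Ck_on_mult Ck_on_inverse)

lemma Ck_on_sqrt:
  assumes "open S" "Ck_on p f S" "\<And>z. z \<in> S \<Longrightarrow> f z > 0"
  shows "Ck_on p (\<lambda>z. sqrt (f z)) S"
  using assms(2,3)
proof (induction p)
  case 0
  then show ?case by (simp add: continuous_on_real_sqrt)
next
  case (Suc p)
  note f = Ck_on_SucD[OF Suc.prems(1) assms(1)]
  have p: "Ck_on p (\<lambda>z. sqrt (f z)) S" using Suc Ck_on_Suc_imp by blast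
  show ?case
  proof (rule Ck_on_SucI[OF assms(1)])
    fix z assume "z \<in> S"
    then show "((\<lambda>z. sqrt (f z)) has_derivative
        (\<lambda>b. frechet_derivative f (at z) b * (inverse (sqrt (f z)) / 2))) (at z)"
      using Suc.prems(2) by (auto intro!: derivative_eq_intros f(1))
  next
    fix b :: 'a assume "b \<in> Basis"
    have "Ck_on p (\<lambda>z. inverse (sqrt (f z))) S"
      using Suc.prems(2) by (intro Ck_on_inverse assms(1) p) (auto simp: less_imp_neq[THEN not_sym])
    then show "Ck_on p (\<lambda>z. frechet_derivative f (at z) b * (inverse (sqrt (f z)) / 2)) S"
      using Ck_on_mult[OF assms(1) f(2)[OF \<open>b \<in> Basis\<close>] Ck_on_mult[OF assms(1) _ Ck_on_const[OF assms(1), of p "1/2"]]]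
      by simp
  qed
qed

section \<open>Directional derivatives on the tangent bundle\<close>

text \<open>
  Base and fibre derivatives are the cases where one component of \<open>e\<close> vanishes. Treating both as one
  operator gives each differentiation rule, and the symmetry of second derivatives, only once. The
  vector \<open>e\<close> need not be a basis vector: \<open>e = (0, y)\<close> is the Euler field.
\<close>

definition Dv :: "(real^2) \<times> (real^2) \<Rightarrow> tfun \<Rightarrow> tfun" where
  "Dv e f x y = deriv (\<lambda>t. f (x + t *\<^sub>R fst e) (y + t *\<^sub>R snd e)) 0"

definition line_diff :: "(real^2) \<times> (real^2) \<Rightarrow> tfun \<Rightarrow> real^2 \<Rightarrow> real^2 \<Rightarrow> bool" where
  "line_diff e f x y \<longleftrightarrow> (\<lambda>t. f (x + t *\<^sub>R fst e) (y + t *\<^sub>R snd e)) field_differentiable (at 0)"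

abbreviation hor :: "2 \<Rightarrow> (real^2) \<times> (real^2)" where "hor n \<equiv> (axis n 1, 0)"

abbreviation ver :: "2 \<Rightarrow> (real^2) \<times> (real^2)" where "ver n \<equiv> (0, axis n 1)"

lemma dx_eq_Dv: "dx n f = Dv (hor n) f" and dy_eq_Dv: "dy n f = Dv (ver n) f"
  by (simp_all add: fun_eq_iff dx_def dy_def Dv_def)

lemma hor_ver_Basis: "hor n \<in> Basis" "ver n \<in> Basis"
  by (simp_all add: Basis_prod_def axis_in_Basis_iff)

lemma line_diff_iff:
  "line_diff e f x y \<longleftrightarrow>
     ((\<lambda>t. f (x + t *\<^sub>R fst e) (y + t *\<^sub>R snd e)) has_real_derivative Dv e f x y) (at 0)"
  by (simp add: line_diff_def Dv_def DERIV_deriv_iff_field_differentiable)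

text \<open>
  Differentiability and the value of the derivative are kept together, so that the simplifier
  discharges the side conditions of the rules below while it computes a derivative.
\<close>

lemma line_derivI:
  assumes "((\<lambda>t. f (x + t *\<^sub>R fst e) (y + t *\<^sub>R snd e)) has_real_derivative v) (at 0)"
  shows "line_diff e f x y \<and> Dv e f x y = v"
  using assms by (auto simp: line_diff_def Dv_def field_differentiable_def intro: DERIV_imp_deriv)

lemma Dv_const: "line_diff e (\<lambda>x y. c) x y \<and> Dv e (\<lambda>x y. c) x y = 0"
  by (rule line_derivI) simp

text \<open>
  Differentiates \<open>k\<^sub>n(x)\<close> along a fibre.
\<close>

lemma Dv_base: "line_diff (0, b) (\<lambda>x y. h x) x y \<and> Dv (0, b) (\<lambda>x y. h x) x y = 0"
  by (rule line_derivI) simp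

lemma Dv_coord: "line_diff e (\<lambda>x y. y $ k) x y \<and> Dv e (\<lambda>x y. y $ k) x y = snd e $ k"
  by (rule line_derivI) (auto intro!: derivative_eq_intros)

lemma Dv_add:
  assumes "line_diff e f x y" "line_diff e g x y"
  shows "line_diff e (\<lambda>x y. f x y + g x y) x y \<and>
    Dv e (\<lambda>x y. f x y + g x y) x y = Dv e f x y + Dv e g x y"
  using DERIV_add[OF assms[unfolded line_diff_iff]] by (intro line_derivI) (simp add: ac_simps)

lemma Dv_minus:
  assumes "line_diff e f x y"
  shows "line_diff e (\<lambda>x y. - f x y) x y \<and> Dv e (\<lambda>x y. - f x y) x y = - Dv e f x y"
  using DERIV_minus[OF assms[unfolded line_diff_iff]] by (intro line_derivI) (simp add: ac_simps)

lemma Dv_diff: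
  assumes "line_diff e f x y" "line_diff e g x y"
  shows "line_diff e (\<lambda>x y. f x y - g x y) x y \<and>
    Dv e (\<lambda>x y. f x y - g x y) x y = Dv e f x y - Dv e g x y"
  using DERIV_diff[OF assms[unfolded line_diff_iff]] by (intro line_derivI) (simp add: ac_simps)

lemma Dv_mult:
  assumes "line_diff e f x y" "line_diff e g x y"
  shows "line_diff e (\<lambda>x y. f x y * g x y) x y \<and>
    Dv e (\<lambda>x y. f x y * g x y) x y = Dv e f x y * g x y + f x y * Dv e g x y"
  using DERIV_mult[OF assms[unfolded line_diff_iff]] by (intro line_derivI) (simp add: ac_simps)

lemma Dv_divide:
  assumes "line_diff e f x y" "line_diff e g x y" "g x y \<noteq> 0"
  shows "line_diff e (\<lambda>x y. f x y / g x y) x y \<and>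
    Dv e (\<lambda>x y. f x y / g x y) x y
      = (Dv e f x y * g x y - f x y * Dv e g x y) / (g x y * g x y)"
  using DERIV_divide[OF assms(1,2)[unfolded line_diff_iff]] assms(3)
  by (intro line_derivI) simp

lemma Dv_sqrt:
  assumes "line_diff e f x y" "f x y > 0"
  shows "line_diff e (\<lambda>x y. sqrt (f x y)) x y \<and>
    Dv e (\<lambda>x y. sqrt (f x y)) x y = Dv e f x y / (2 * sqrt (f x y))"
  using DERIV_chain2[OF DERIV_real_sqrt assms(1)[unfolded line_diff_iff]] assms(2)
  by (intro line_derivI) (simp add: field_simps)

lemma Dv_ln_abs:
  assumes "line_diff e f x y" "f x y \<noteq> 0"
  shows "Dv e (\<lambda>x y. ln \<bar>f x y\<bar>) x y = Dv e f x y / f x y"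
proof -
  have "((\<lambda>u. ln \<bar>u\<bar>) has_real_derivative 1 / f x y) (at (f x y))"
  proof -
    have "\<forall>\<^sub>F u in nhds (f x y). ln \<bar>u\<bar> = ln (sgn (f x y) * u)"
    proof -
      have "\<forall>\<^sub>F u in nhds (f x y). sgn (f x y) * u > 0"
        using assms(2)
        by (intro order_tendstoD(1)[where y = "sgn (f x y) * f x y"] tendsto_intros filterlim_ident)
          (simp add: sgn_if)
      then show ?thesis
        by eventually_elim (use assms(2) in \<open>auto simp: sgn_if abs_if split: if_splits\<close>)
    qed
    moreover have "((\<lambda>u. ln (sgn (f x y) * u)) has_real_derivative 1 / f x y) (at (f x y))"
      using assms(2) by (auto intro!: derivative_eq_intros simp: sgn_if)
    ultimately show ?thesis by (simp add: DERIV_cong_ev)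
  qed
  from DERIV_chain2[where x = 0, OF _ assms(1)[unfolded line_diff_iff], of "\<lambda>u. ln \<bar>u\<bar>" "1 / f x y"] this
  have "((\<lambda>t. ln \<bar>f (x + t *\<^sub>R fst e) (y + t *\<^sub>R snd e)\<bar>) has_real_derivative
      (1 / f x y) * Dv e f x y) (at 0)"
    by simp
  then show ?thesis using line_derivI[of "\<lambda>x y. ln \<bar>f x y\<bar>"] by simp
qed

lemmas Dv_rules =
  Dv_const Dv_base Dv_coord Dv_add Dv_minus Dv_diff Dv_mult Dv_divide Dv_sqrt

locale open_region =
  fixes W :: "((real^2) \<times> (real^2)) set"
  assumes open_W: "open W"
begin

abbreviation C :: "nat \<Rightarrow> tfun \<Rightarrow> bool" where
  "C p f \<equiv> Ck_on p (case_prod f) W"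

lemma frechet_eq_Dv:
  assumes "C (Suc p) f" "(x, y) \<in> W"
  shows "frechet_derivative (case_prod f) (at (x, y)) e = Dv e f x y"
    and "line_diff e f x y"
proof -
  have "((\<lambda>t. case_prod f ((x, y) + t *\<^sub>R e)) has_real_derivative
      frechet_derivative (case_prod f) (at ((x, y) + 0 *\<^sub>R e)) e) (at 0)"
    by (rule has_derivative_along_line) (use Ck_on_imp_differentiable[OF assms(1) open_W assms(2)] in simp)
  then have "((\<lambda>t. f (x + t *\<^sub>R fst e) (y + t *\<^sub>R snd e)) has_real_derivative
      frechet_derivative (case_prod f) (at (x, y)) e) (at 0)"
    by (simp add: case_prod_beta)
  from line_derivI[OF this] show "frechet_derivative (case_prod f) (at (x, y)) e = Dv e f x y"
    "line_diff e f x y" by simp_all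
qed

lemma C_cong: "(\<And>x y. (x, y) \<in> W \<Longrightarrow> f x y = g x y) \<Longrightarrow> C p f \<longleftrightarrow> C p g"
  by (rule Ck_on_cong[OF open_W]) auto

lemma Dv_cong:
  assumes "\<And>x y. (x, y) \<in> W \<Longrightarrow> f x y = g x y" "(x, y) \<in> W"
  shows "Dv e f x y = Dv e g x y"
proof -
  have "((\<lambda>t. (x, y) + t *\<^sub>R e) \<longlongrightarrow> (x, y)) (nhds 0)"
    by (rule tendsto_eq_intros filterlim_ident refl)+ simp
  then have "\<forall>\<^sub>F t in nhds 0. (x, y) + t *\<^sub>R e \<in> W"
    using open_W assms(2) by (rule topological_tendstoD)
  then have "\<forall>\<^sub>F t in nhds 0. f (x + t *\<^sub>R fst e) (y + t *\<^sub>R snd e) = g (x + t *\<^sub>R fst e) (y + t *\<^sub>R snd e)"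
    by eventually_elim (use assms(1) in \<open>auto simp: plus_prod_def\<close>)
  then show ?thesis unfolding Dv_def by (intro deriv_cong_ev) auto
qed

lemma C_Dv: "C (Suc p) f \<Longrightarrow> e \<in> Basis \<Longrightarrow> C p (Dv e f)"
  using Ck_on_SucD(2)[OF _ open_W, of p "case_prod f" e]
    Ck_on_cong[OF open_W, of "\<lambda>z. frechet_derivative (case_prod f) (at z) e" "case_prod (Dv e f)" p]
    frechet_eq_Dv(1)[of p f _ _ e] by (auto simp del: Ck_on.simps)

text \<open>
  \<open>Dv\<close> is a derivative along a single line, while the symmetry of second derivatives concerns the
  total derivative; for \<open>C\<^sup>2\<close> functions the two agree in both orders of differentiation.
\<close>

lemma Dv_commute:
  assumes "C (Suc (Suc p)) f" "(x, y) \<in> W" "a \<in> Basis" "b \<in> Basis"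
  shows "Dv a (Dv b f) x y = Dv b (Dv a f) x y"
proof -
  let ?D = "\<lambda>b f z. frechet_derivative f (at z) b"
  have D: "?D e (case_prod f) z = case_prod (Dv e f) z" if "z \<in> W" for e z
    using frechet_eq_Dv(1)[OF assms(1)] that by (cases z) auto
  have DD: "?D e' (?D e (case_prod f)) z = case_prod (Dv e' (Dv e f)) z"
    if "z \<in> W" "e \<in> Basis" for e e' z
  proof -
    have "?D e' (?D e (case_prod f)) z = ?D e' (case_prod (Dv e f)) z"
      using frechet_derivative_cong_open[OF open_W that(1) D] by simp
    also have "\<dots> = case_prod (Dv e' (Dv e f)) z"
      using frechet_eq_Dv(1)[OF C_Dv[OF assms(1) that(2)]] that(1) by (cases z) auto
    finally show ?thesis .
  qed
  have C1: "Ck_on (Suc p) (?D e (case_prod f)) W" if "e \<in> Basis" for e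
    using Ck_on_SucD(2)[OF assms(1) open_W that] .
  have C0: "continuous_on W (?D e' (?D e (case_prod f)))" if "e \<in> Basis" "e' \<in> Basis" for e e'
    using Ck_on_imp_continuous[OF Ck_on_SucD(2)[OF C1[OF that(1)] open_W that(2)]] .
  have "?D a (?D b (case_prod f)) (x, y) = ?D b (?D a (case_prod f)) (x, y)"
    using assms(1) C1[OF assms(3)] C1[OF assms(4)]
    by (intro mixed_derivatives_commute[OF open_W assms(2)] C0 assms(3,4)) simp_all
  then show ?thesis by (simp add: DD assms)
qed

lemma C_mono: "C q f \<Longrightarrow> p \<le> q \<Longrightarrow> C p f"
  by (rule Ck_on_mono)

lemma C_const: "C p (\<lambda>x y. c)"
  using Ck_on_const[OF open_W] by (simp only: case_prod_beta')

lemma C_coord: "C p (\<lambda>x y. y $ k)"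
  unfolding case_prod_beta'
  by (intro Ck_on_linear open_W bounded_linear_compose[OF bounded_linear_vec_nth bounded_linear_snd])

lemma C_add: "C p f \<Longrightarrow> C p g \<Longrightarrow> C p (\<lambda>x y. f x y + g x y)"
  unfolding case_prod_beta' by (rule Ck_on_add[OF open_W])

lemma C_minus: "C p f \<Longrightarrow> C p (\<lambda>x y. - f x y)"
  unfolding case_prod_beta' by (rule Ck_on_minus[OF open_W])

lemma C_diff: "C p f \<Longrightarrow> C p g \<Longrightarrow> C p (\<lambda>x y. f x y - g x y)"
  unfolding case_prod_beta' by (rule Ck_on_diff[OF open_W])

lemma C_mult: "C p f \<Longrightarrow> C p g \<Longrightarrow> C p (\<lambda>x y. f x y * g x y)"
  unfolding case_prod_beta' by (rule Ck_on_mult[OF open_W])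

lemma C_divide:
  "C p f \<Longrightarrow> C p g \<Longrightarrow> (\<And>x y. (x, y) \<in> W \<Longrightarrow> g x y \<noteq> 0) \<Longrightarrow> C p (\<lambda>x y. f x y / g x y)"
  unfolding case_prod_beta' by (rule Ck_on_divide[OF open_W]) auto

lemma C_sqrt:
  "C p f \<Longrightarrow> (\<And>x y. (x, y) \<in> W \<Longrightarrow> f x y > 0) \<Longrightarrow> C p (\<lambda>x y. sqrt (f x y))"
  unfolding case_prod_beta' by (rule Ck_on_sqrt[OF open_W]) auto

lemma C_sum: "(\<And>i. i \<in> A \<Longrightarrow> C p (f i)) \<Longrightarrow> C p (\<lambda>x y. \<Sum>i\<in>A. f i x y)"
  by (induction A rule: infinite_finite_induct) (simp_all add: C_const C_add)

lemma line_diff_C: "C p f \<Longrightarrow> 0 < p \<Longrightarrow> (x, y) \<in> W \<Longrightarrow> line_diff e f x y"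
  using frechet_eq_Dv(2)[of "p - 1"] by simp

lemma Dv_fibre_direction:
  assumes "C (Suc p) f" "(x, y) \<in> W"
  shows "Dv (0, v) f x y = v $ 1 * dy 1 f x y + v $ 2 * dy 2 f x y"
proof -
  have "linear (frechet_derivative (case_prod f) (at (x, y)))"
    using Ck_on_imp_differentiable[OF assms(1) open_W assms(2)] by (rule linear_frechet_derivative)
  moreover have "(0, v) = v $ 1 *\<^sub>R ver 1 + v $ 2 *\<^sub>R ver 2"
    by (simp add: vec_eq_iff axis_def forall_2)
  ultimately show ?thesis
    by (simp only: frechet_eq_Dv(1)[OF assms, symmetric] dy_eq_Dv linear_add linear_scale) simp
qed

text \<open>
  Both sides are the derivative of \<open>f x (y + t *\<^sub>R y)\<close> at \<open>t = 0\<close>, where homogeneity applies as long as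
  \<open>t > -1\<close>.
\<close>

lemma euler_homogeneous:
  assumes "C (Suc p) f" "(x, y) \<in> W" "\<And>t. t > 0 \<Longrightarrow> f x (t *\<^sub>R y) = t * f x y"
  shows "y $ 1 * dy 1 f x y + y $ 2 * dy 2 f x y = f x y"
proof -
  have "\<forall>\<^sub>F t in nhds (0::real). t > -1"
    by (rule order_tendstoD) (auto intro: filterlim_ident)
  then have "\<forall>\<^sub>F t in nhds 0. f x (y + t *\<^sub>R y) = (1 + t) * f x y"
  proof eventually_elim
    case (elim t)
    then show ?case using assms(3)[of "1 + t"] by (simp add: scaleR_add_left)
  qed
  then have "Dv (0, y) f x y = deriv (\<lambda>t. (1 + t) * f x y) 0"
    unfolding Dv_def by (intro deriv_cong_ev) simp_all
  also have "\<dots> = f x y"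
    by (rule DERIV_imp_deriv) (auto intro!: derivative_eq_intros)
  finally show ?thesis using Dv_fibre_direction[OF assms(1,2)] by metis
qed

end

section \<open>Metric, Berwald frame and main scalar of a Finsler plane\<close>

lemma axis_component: "axis k c $ j = (if j = k then c else 0)"
  by (simp add: axis_def)

text \<open>
  With \<open>Q\<close> the quadratic form of the matrix \<open>(a, b; b, d)\<close> at \<open>(u, v)\<close> and \<open>R\<^sup>2\<close> its determinant, these are the
  completions of the square that give \<open>g\<^sub>i\<^sub>j = l\<^sub>i l\<^sub>j + m\<^sub>i m\<^sub>j\<close> after division by \<open>Q = F\<^sup>2\<close>.
\<close>

lemma quadratic_completion:
  fixes Q R a b d u v :: real
  assumes "R * R = a * d - b * b" "Q = a * (u * u) + 2 * b * u * v + d * (v * v)"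
  shows "Q * a = (a * u + b * v) * (a * u + b * v) + - (R * v) * - (R * v)"
    and "Q * b = (a * u + b * v) * (b * u + d * v) + - (R * v) * (R * u)"
    and "Q * d = (b * u + d * v) * (b * u + d * v) + (R * u) * (R * u)"
proof -
  have *: "- (R * v) * - (R * v) = (R * R) * (v * v)" "- (R * v) * (R * u) = - ((R * R) * (u * v))"
    "(R * u) * (R * u) = (R * R) * (u * u)" by simp_all
  show "Q * a = (a * u + b * v) * (a * u + b * v) + - (R * v) * - (R * v)"
    "Q * b = (a * u + b * v) * (b * u + d * v) + - (R * v) * (R * u)"
    "Q * d = (b * u + d * v) * (b * u + d * v) + (R * u) * (R * u)"
    unfolding * assms by (simp_all add: algebra_simps)
qed

locale finsler_region =
  fixes U :: "(real^2) set" and W :: "((real^2) \<times> (real^2)) set" and F :: tfun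
  assumes conic: "conic_region U W" and finsler: "finsler_metric_on W F"
begin

sublocale open_region W
  using conic by unfold_locales (simp add: conic_region_def)

abbreviation "g i j \<equiv> \<lambda>x y. metric F x y $ i $ j"

lemma F_C4: "C 4 F"
  using finsler by (simp add: finsler_metric_on_def)

lemma F_pos: "(x, y) \<in> W \<Longrightarrow> F x y > 0"
  using finsler by (auto simp: finsler_metric_on_def)

lemma dyF_C3: "C 3 (dy i F)"
  using C_Dv[of 3 F "ver i"] F_C4 by (simp add: dy_eq_Dv hor_ver_Basis del: Ck_on.simps)

lemma metric_fun_eq: "g i j = dy j (y_dn F i)"
  by (simp add: metric_def fun_eq_iff)

lemma metric_dy_eq: "metric F x y $ i $ j = dy j (y_dn F i) x y"
  by (simp add: metric_def)

lemma y_dn_fun_eq: "y_dn F i = (\<lambda>x y. F x y * dy i F x y)"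
  by (simp add: y_dn_def fun_eq_iff)

lemma y_dn_C3: "C 3 (y_dn F i)"
  unfolding y_dn_fun_eq using C_mono[OF F_C4, of 3] by (intro C_mult dyF_C3) simp

lemma g_C2: "C 2 (g i j)"
  using C_Dv[of 2 "y_dn F i" "ver j"] y_dn_C3 unfolding metric_fun_eq
  by (simp add: dy_eq_Dv hor_ver_Basis numeral_3_eq_3 del: Ck_on.simps)

lemma dg_C1: "C 1 (dy k (g i j))"
  using C_Dv[of 1 "g i j" "ver k"] g_C2
  by (simp add: dy_eq_Dv hor_ver_Basis numeral_2_eq_2 del: Ck_on.simps)

context
  fixes x y assumes xy: "(x, y) \<in> W"
begin

lemma dy_commute: "C 2 f \<Longrightarrow> dy i (dy j f) x y = dy j (dy i f) x y"
  using Dv_commute[of 0 f x y "ver i" "ver j"] xy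
  by (simp add: dy_eq_Dv hor_ver_Basis numeral_2_eq_2 del: Ck_on.simps)

lemma euler_F: "y $ 1 * dy 1 F x y + y $ 2 * dy 2 F x y = F x y"
  using F_C4 xy finsler
  by (intro euler_homogeneous[of 3]) (auto simp: finsler_metric_on_def simp del: Ck_on.simps)

lemma line_diff_F: "line_diff e F x y" and line_diff_dyF: "line_diff e (dy i F) x y"
  and line_diff_g: "line_diff e (g i j) x y" and line_diff_dg: "line_diff e (dy k (g i j)) x y"
  using line_diff_C[OF F_C4 _ xy] line_diff_C[OF dyF_C3 _ xy] line_diff_C[OF g_C2 _ xy]
    line_diff_C[OF dg_C1 _ xy] by simp_all

end

text \<open>
  Differentiating Euler's relation along the fibre avoids any argument about how the derivatives of
  \<open>F\<close> scale.
\<close>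

lemma euler_dyF:
  assumes xy: "(x, y) \<in> W"
  shows "y $ 1 * dy j (dy 1 F) x y + y $ 2 * dy j (dy 2 F) x y = 0"
proof -
  have "dy j (\<lambda>x y. y $ 1 * dy 1 F x y + y $ 2 * dy 2 F x y) x y = dy j F x y"
    unfolding dy_eq_Dv by (rule Dv_cong[OF _ xy]) (simp add: euler_F flip: dy_eq_Dv)
  then show ?thesis
    using exhaust_2[of j]
    by (auto simp: dy_eq_Dv Dv_rules line_diff_dyF[OF xy, unfolded dy_eq_Dv] axis_component)
qed

lemma metric_eq:
  assumes xy: "(x, y) \<in> W"
  shows "g i j x y = dy i F x y * dy j F x y + F x y * dy j (dy i F) x y"
  unfolding metric_dy_eq y_dn_fun_eq
  by (simp add: dy_eq_Dv Dv_mult line_diff_F[OF xy] line_diff_dyF[OF xy, unfolded dy_eq_Dv])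

lemma metric_sym:
  assumes xy: "(x, y) \<in> W"
  shows "g i j x y = g j i x y"
  using dy_commute[OF xy C_mono[OF F_C4], of i j] by (simp add: metric_eq[OF xy])

lemma metric_radial:
  assumes xy: "(x, y) \<in> W"
  shows "g i 1 x y * y $ 1 + g i 2 x y * y $ 2 = y_dn F i x y"
proof -
  have "g i 1 x y * y $ 1 + g i 2 x y * y $ 2 = g 1 i x y * y $ 1 + g 2 i x y * y $ 2"
    by (simp add: metric_sym[OF xy, of i])
  also have "\<dots> = (y $ 1 * dy 1 F x y + y $ 2 * dy 2 F x y) * dy i F x y
      + F x y * (y $ 1 * dy i (dy 1 F) x y + y $ 2 * dy i (dy 2 F) x y)"
    by (simp add: metric_eq[OF xy] algebra_simps)
  finally show ?thesis by (simp only: euler_F[OF xy] euler_dyF[OF xy] y_dn_def)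
qed

lemma dg_sym:
  assumes xy: "(x, y) \<in> W"
  shows "dy k (g i j) x y = dy k (g j i) x y" "dy k (g i j) x y = dy j (g i k) x y"
proof -
  show "dy k (g i j) x y = dy k (g j i) x y"
    unfolding dy_eq_Dv by (rule Dv_cong[OF _ xy]) (rule metric_sym)
  show "dy k (g i j) x y = dy j (g i k) x y"
    unfolding metric_fun_eq by (rule dy_commute[OF xy C_mono[OF y_dn_C3]]) simp
qed

text \<open>
  The fibre derivative of \<open>g\<^sub>i\<^sub>j y\<^sup>j = y\<^sub>i\<close>: the term where \<open>y\<^sup>j\<close> is differentiated already accounts for
  the right side, so \<open>C\<^sub>i\<^sub>j\<^sub>k y\<^sup>j = 0\<close>.
\<close>

lemma dmetric_radial:
  assumes xy: "(x, y) \<in> W"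
  shows "dy k (g i 1) x y * y $ 1 + dy k (g i 2) x y * y $ 2 = 0"
proof -
  have "dy k (\<lambda>x y. g i 1 x y * y $ 1 + g i 2 x y * y $ 2) x y = dy k (y_dn F i) x y"
    unfolding dy_eq_Dv by (rule Dv_cong[OF _ xy]) (rule metric_radial)
  moreover have "dy k (y_dn F i) x y = g i k x y"
    by (simp only: metric_dy_eq)
  ultimately show ?thesis
    using exhaust_2[of k]
    by (auto simp: dy_eq_Dv Dv_rules line_diff_g[OF xy] axis_component)
qed

lemma euler_metric:
  assumes xy: "(x, y) \<in> W"
  shows "dy 1 (g i j) x y * y $ 1 + dy 2 (g i j) x y * y $ 2 = 0"
  using dmetric_radial[OF xy, of j i] dg_sym(2)[OF xy, of 1 i j] dg_sym(2)[OF xy, of 2 i j]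
  by (simp only:)

text \<open>
  The fibre derivative of the preceding relation: the Cartan tensor is homogeneous of degree -1.
\<close>

lemma euler_dmetric:
  assumes xy: "(x, y) \<in> W"
  shows "dy 1 (dy k (g i j)) x y * y $ 1 + dy 2 (dy k (g i j)) x y * y $ 2 = - dy k (g i j) x y"
proof -
  have "dy k (\<lambda>x y. dy 1 (g i j) x y * y $ 1 + dy 2 (g i j) x y * y $ 2) x y
      = dy k (\<lambda>x y. 0) x y"
    unfolding dy_eq_Dv by (rule Dv_cong[OF _ xy]) (simp add: euler_metric flip: dy_eq_Dv)
  then have "dy k (dy 1 (g i j)) x y * y $ 1 + dy k (dy 2 (g i j)) x y * y $ 2
      = - dy k (g i j) x y"
    using exhaust_2[of k]
    by (auto simp: dy_eq_Dv Dv_rules line_diff_dg[OF xy, unfolded dy_eq_Dv] axis_component algebra_simps)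
  then show ?thesis
    using dy_commute[OF xy g_C2, of k 1 i j] dy_commute[OF xy g_C2, of k 2 i j] by (simp only:)
qed

lemma det_metric: "(x, y) \<in> W \<Longrightarrow> det (metric F x y) = g 1 1 x y * g 2 2 x y - g 1 2 x y * g 1 2 x y"
  using metric_sym[of x y 2 1] by (simp add: det_2)

lemma det_pos:
  assumes xy: "(x, y) \<in> W"
  shows "det (metric F x y) > 0"
proof -
  have pos: "v \<bullet> (metric F x y *v v) > 0" if "v \<noteq> 0" for v
    using finsler xy that by (auto simp: finsler_metric_on_def)
  have form: "v \<bullet> (metric F x y *v v) = g 1 1 x y * (v$1)\<^sup>2 + 2 * g 1 2 x y * v$1 * v$2 + g 2 2 x y * (v$2)\<^sup>2" for v
    using metric_sym[OF xy, of 2 1]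
    by (simp add: inner_vec_def matrix_vector_mult_def sum_2 algebra_simps power2_eq_square)
  have g11: "g 1 1 x y > 0"
    using pos[of "axis 1 1"] by (simp add: form axis_component axis_eq_0_iff)
  \<comment> \<open>The value of the form at this vector is \<open>g\<^sub>1\<^sub>1 det g\<close>.\<close>
  define v :: "real^2" where "v = vector [- g 1 2 x y, g 1 1 x y]"
  have "v \<noteq> 0" using g11 by (auto simp: v_def vec_eq_iff forall_2)
  from pos[OF this] have "g 1 1 x y * det (metric F x y) > 0"
    by (simp add: form v_def det_metric[OF xy] algebra_simps power2_eq_square)
  then show ?thesis using g11 by (simp add: zero_less_mult_iff)
qed

abbreviation "r \<equiv> \<lambda>x y. sqrt (det (metric F x y))"

lemma det_C2: "C 2 (\<lambda>x y. det (metric F x y))"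
  unfolding det_2 by (intro C_diff C_mult g_C2)

lemma r_C2: "C 2 r"
  by (intro C_sqrt det_C2) (rule det_pos)

lemma m_dn_eq: "m_dn F 1 = (\<lambda>x y. - (r x y * y $ 2 / F x y))" "m_dn F 2 = (\<lambda>x y. r x y * y $ 1 / F x y)"
  by (simp_all add: m_dn_def fun_eq_iff eps_def gam_def l_up_def sum_2)

lemma m_dn_C2: "C 2 (m_dn F i)"
proof -
  have "C 2 (\<lambda>x y. r x y * y $ k / F x y)" for k
    using C_mono[OF F_C4, of 2] F_pos by (intro C_divide C_mult r_C2 C_coord) force+
  from this[of 1] C_minus[OF this[of 2]] show ?thesis
    using exhaust_2[of i] by (auto simp: m_dn_eq simp del: Ck_on.simps)
qed

lemma g_up_inverse:
  assumes "(x, y) \<in> W"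
  shows "(\<Sum>j\<in>UNIV. g_up F i j x y * g j k x y) = (if i = k then 1 else 0)"
proof -
  have "invertible (metric F x y)"
    using det_pos[OF assms] by (simp add: invertible_det_nz)
  then have "matrix_inv (metric F x y) ** metric F x y = mat 1"
    unfolding invertible_def matrix_inv_def by (rule someI2_ex) simp
  then have "(matrix_inv (metric F x y) ** metric F x y) $ i $ k = mat 1 $ i $ k"
    by simp
  then show ?thesis by (simp add: matrix_matrix_mult_def g_up_def mat_def)
qed

text \<open>
  The vector on the right is the one with \<open>l\<^sub>i m\<^sup>i = 0\<close> and \<open>m\<^sub>i m\<^sup>i = 1\<close>; lowering its index with \<open>g\<close> gives \<open>m\<^sub>j\<close>.
  Knowing it explicitly, no derivative of the inverse metric has to be computed.
\<close>

lemma m_up_eq: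
  assumes xy: "(x, y) \<in> W"
  shows "m_up F 1 x y = - dy 2 F x y / r x y" "m_up F 2 x y = dy 1 F x y / r x y"
proof -
  define M where "M k = (if k = 1 then - dy 2 F x y / r x y else dy 1 F x y / r x y)" for k :: 2
  have r: "r x y > 0" "r x y * r x y = det (metric F x y)"
    using det_pos[OF xy] by simp_all
  note Fy = metric_radial[OF xy, of 1] metric_radial[OF xy, of 2]
  have "m_dn F j x y = (\<Sum>k\<in>UNIV. g j k x y * M k)" for j
  proof -
    have 1: "F x y * (g 1 2 x y * dy 1 F x y - g 1 1 x y * dy 2 F x y) = - (r x y * r x y) * y $ 2"
      using Fy unfolding r(2) unfolding det_metric[OF xy] y_dn_def metric_sym[OF xy, of 2 1] by algebra
    have 2: "F x y * (g 2 2 x y * dy 1 F x y - g 2 1 x y * dy 2 F x y) = (r x y * r x y) * y $ 1"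
      using Fy unfolding r(2) unfolding det_metric[OF xy] y_dn_def metric_sym[OF xy, of 2 1] by algebra
    show ?thesis
      using exhaust_2[of j] 1 2 r(1) F_pos[OF xy]
      by (auto simp: sum_2 M_def m_dn_eq field_simps)
  qed
  then have "m_up F i x y = (\<Sum>j\<in>UNIV. \<Sum>k\<in>UNIV. g_up F i j x y * g j k x y * M k)" for i
    by (simp add: m_up_def sum_distrib_left mult.assoc)
  also have "\<dots> i = (\<Sum>k\<in>UNIV. (\<Sum>j\<in>UNIV. g_up F i j x y * g j k x y) * M k)" for i
    by (subst sum.swap) (simp add: sum_distrib_right)
  also have "\<dots> i = M i" for i
    using exhaust_2[of i] by (auto simp: g_up_inverse[OF xy] sum_2)
  finally show "m_up F 1 x y = - dy 2 F x y / r x y" "m_up F 2 x y = dy 1 F x y / r x y"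
    by (simp_all add: M_def)
qed

lemma m_up_C2: "C 2 (m_up F i)"
proof -
  have "C 2 (\<lambda>x y. dy k F x y / r x y)" for k
    using C_mono[OF dyF_C3, of 2] det_pos by (intro C_divide r_C2) force+
  moreover from this have "C 2 (\<lambda>x y. - dy k F x y / r x y)" for k
    using C_minus[of 2 "\<lambda>x y. dy k F x y / r x y"] by simp
  ultimately show ?thesis
    using exhaust_2[of i] C_cong[of "m_up F 1" "\<lambda>x y. - dy 2 F x y / r x y" 2]
      C_cong[of "m_up F 2" "\<lambda>x y. dy 1 F x y / r x y" 2] m_up_eq
    by (auto simp del: Ck_on.simps)
qed

lemma l_up_C4: "C 4 (l_up F k)"
  using F_C4 F_pos C_divide[OF C_coord F_C4, of k] by (force simp: l_up_def[abs_def] simp del: Ck_on.simps)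

lemma frame:
  assumes xy: "(x, y) \<in> W"
  shows "dy 1 F x y * l_up F 1 x y + dy 2 F x y * l_up F 2 x y = 1"
    "m_dn F 1 x y * m_up F 1 x y + m_dn F 2 x y * m_up F 2 x y = 1"
    "dy 1 F x y * m_up F 1 x y + dy 2 F x y * m_up F 2 x y = 0"
    "m_dn F 1 x y * l_up F 1 x y + m_dn F 2 x y * l_up F 2 x y = 0"
    "l_up F k x y * dy i F x y + m_up F k x y * m_dn F i x y = (if k = i then 1 else 0)"
proof -
  note s = m_up_eq[OF xy] m_dn_eq l_up_def
  have p: "r x y > 0" "F x y > 0" using det_pos[OF xy] F_pos[OF xy] by simp_all
  note E = euler_F[OF xy]
  show "dy 1 F x y * l_up F 1 x y + dy 2 F x y * l_up F 2 x y = 1"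
    "m_dn F 1 x y * m_up F 1 x y + m_dn F 2 x y * m_up F 2 x y = 1"
    "dy 1 F x y * m_up F 1 x y + dy 2 F x y * m_up F 2 x y = 0"
    "m_dn F 1 x y * l_up F 1 x y + m_dn F 2 x y * l_up F 2 x y = 0"
    using p E by (simp_all add: s field_simps)
  show "l_up F k x y * dy i F x y + m_up F k x y * m_dn F i x y = (if k = i then 1 else 0)"
    using exhaust_2[of k] exhaust_2[of i] p E by (auto simp: s field_simps)
qed

lemma metric_frame:
  assumes xy: "(x, y) \<in> W"
  shows "g i j x y = dy i F x y * dy j F x y + m_dn F i x y * m_dn F j x y"
proof -
  have r: "r x y * r x y = g 1 1 x y * g 2 2 x y - g 1 2 x y * g 1 2 x y"
    using det_pos[OF xy] det_metric[OF xy] by simp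
  have p: "F x y > 0" using F_pos[OF xy] by simp
  have Fl: "F x y * dy k F x y = g k 1 x y * y $ 1 + g k 2 x y * y $ 2" for k
    using metric_radial[OF xy, of k] by (simp add: y_dn_def)
  have m: "F x y * m_dn F 1 x y = - (r x y * y $ 2)" "F x y * m_dn F 2 x y = r x y * y $ 1"
    using p by (simp_all add: m_dn_eq)
  have "F x y * F x y = y $ 1 * (F x y * dy 1 F x y) + y $ 2 * (F x y * dy 2 F x y)"
    by (subst (2) euler_F[OF xy, symmetric]) (simp only: algebra_simps)
  then have FF: "F x y * F x y
      = g 1 1 x y * (y $ 1 * y $ 1) + 2 * g 1 2 x y * y $ 1 * y $ 2 + g 2 2 x y * (y $ 2 * y $ 2)"
    unfolding Fl metric_sym[OF xy, of 2 1] by (simp add: algebra_simps)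
  note quad = quadratic_completion[OF r FF]
  let ?h = "\<lambda>i j. (F x y * dy i F x y) * (F x y * dy j F x y) + (F x y * m_dn F i x y) * (F x y * m_dn F j x y)"
  have h: "(F x y * F x y) * g 1 1 x y = ?h 1 1" "(F x y * F x y) * g 1 2 x y = ?h 1 2"
    "(F x y * F x y) * g 2 2 x y = ?h 2 2"
    unfolding Fl m metric_sym[OF xy, of 2 1] by (fact quad)+
  have "?h 2 1 = ?h 1 2"
    by (rule arg_cong2[where f = "(+)"]) (rule mult.commute)+
  then have h': "(F x y * F x y) * g 2 1 x y = ?h 2 1"
    using h(2) metric_sym[OF xy, of 2 1] by (simp only:)
  have "(F x y * F x y) * g i j x y = ?h i j"
    using exhaust_2[of i] exhaust_2[of j] by (elim disjE; hypsubst; intro h h')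
  then have "(F x y * F x y) * g i j x y
      = (F x y * F x y) * (dy i F x y * dy j F x y + m_dn F i x y * m_dn F j x y)"
    by (simp only: algebra_simps)
  then show ?thesis using p by simp
qed

text \<open>
  The covectors that annihilate \<open>y\<close> are the multiples of \<open>m\<close>, by completeness of the frame.
\<close>

lemma frame_kernel:
  assumes xy: "(x, y) \<in> W" and v: "v 1 * y $ 1 + v 2 * y $ 2 = 0"
  shows "v k = (v 1 * m_up F 1 x y + v 2 * m_up F 2 x y) * m_dn F k x y"
proof -
  have "v 1 * l_up F 1 x y + v 2 * l_up F 2 x y = 0"
    using v by (simp add: l_up_def flip: add_divide_distrib)
  moreover have "v k = v 1 * (if 1 = k then 1 else 0) + v 2 * (if 2 = k then 1 else 0)"
    using exhaust_2[of k] by auto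
  ultimately show ?thesis
    unfolding frame(5)[OF xy, symmetric] by algebra
qed

text \<open>
  In each of its three slots the symmetric tensor \<open>A\<close> annihilates \<open>y\<close>, so \<open>frame_kernel\<close> splits off one
  factor \<open>m\<close> per slot.
\<close>

lemma cartan_frame:
  assumes xy: "(x, y) \<in> W"
  shows "A_dn F i j k x y =
    (\<Sum>a\<in>UNIV. \<Sum>b\<in>UNIV. \<Sum>c\<in>UNIV. A_dn F a b c x y * m_up F a x y * m_up F b x y * m_up F c x y)
      * m_dn F i x y * m_dn F j x y * m_dn F k x y"
proof -
  let ?A = "\<lambda>i j k. A_dn F i j k x y" and ?M = "\<lambda>k. m_up F k x y" and ?m = "\<lambda>k. m_dn F k x y"
  have A: "?A i j k = F x y / 2 * dy k (g i j) x y" for i j k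
    by (simp add: A_dn_def C_dn_def)
  have sym1: "?A i j k = ?A j i k" and sym2: "?A i j k = ?A i k j" for i j k
    unfolding A by (rule arg_cong[OF dg_sym(1)[OF xy]], rule arg_cong[OF dg_sym(2)[OF xy]])
  have y3: "?A i j 1 * y $ 1 + ?A i j 2 * y $ 2 = 0" for i j
    using euler_metric[OF xy, of i j] unfolding A by algebra
  have 3: "?A i j k = (?A i j 1 * ?M 1 + ?A i j 2 * ?M 2) * ?m k" for i j k
    using frame_kernel[OF xy, of "?A i j"] y3 by blast
  have 2: "?A i j k = (?A i 1 k * ?M 1 + ?A i 2 k * ?M 2) * ?m j" for i j k
    using 3[of i k j] by (simp only: sym2[of i k])
  have 1: "?A i j k = (?A 1 j k * ?M 1 + ?A 2 j k * ?M 2) * ?m i" for i j k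
    using 2[of j i k] by (simp only: sym1[of j])
  \<comment> \<open>The iterated contractions of \<open>A\<close> with \<open>m\<^sup>c\<close> and then \<open>m\<^sup>b\<close>.\<close>
  define S2 where "S2 i j = ?A i j 1 * ?M 1 + ?A i j 2 * ?M 2" for i j
  define S1 where "S1 i = S2 i 1 * ?M 1 + S2 i 2 * ?M 2" for i
  have S2: "S2 i j = S1 i * ?m j" for i j
    unfolding S1_def S2_def using 2[of i j 1] 2[of i j 2] by algebra
  have S1: "S1 i = (S1 1 * ?M 1 + S1 2 * ?M 2) * ?m i" for i
  proof -
    have "S2 i j = (S2 1 j * ?M 1 + S2 2 j * ?M 2) * ?m i" for j
      unfolding S2_def using 1[of i j 1] 1[of i j 2] by algebra
    from this[of 1] this[of 2] show ?thesis
      unfolding S1_def by algebra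
  qed
  have "?A i j k = S2 i j * ?m k"
    using 3[of i j k] by (simp only: S2_def)
  also have "\<dots> = S1 i * ?m j * ?m k"
    by (simp only: S2[of i j])
  also have "\<dots> = (S1 1 * ?M 1 + S1 2 * ?M 2) * ?m i * ?m j * ?m k"
    by (subst S1[of i]) (rule refl)
  finally have "?A i j k = (S1 1 * ?M 1 + S1 2 * ?M 2) * ?m i * ?m j * ?m k" .
  then show ?thesis
    by (simp add: sum_2 S1_def S2_def algebra_simps)
qed

text \<open>
  The coefficient is unique since contraction with \<open>m\<^sup>a m\<^sup>b m\<^sup>c\<close> recovers it. This contraction is the
  form in which the main scalar is differentiated.
\<close>

lemma main_scalar_eq:
  assumes xy: "(x, y) \<in> W"
  shows "main_scalar F x y =
    (\<Sum>a\<in>UNIV. \<Sum>b\<in>UNIV. \<Sum>c\<in>UNIV. A_dn F a b c x y * m_up F a x y * m_up F b x y * m_up F c x y)"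
    (is "_ = ?s")
  unfolding main_scalar_def
proof (rule the_equality)
  show "\<forall>i j k. A_dn F i j k x y = ?s * m_dn F i x y * m_dn F j x y * m_dn F k x y"
    by (intro allI) (rule cartan_frame[OF xy])
  fix c assume c: "\<forall>i j k. A_dn F i j k x y = c * m_dn F i x y * m_dn F j x y * m_dn F k x y"
  have "?s = (\<Sum>a\<in>UNIV. \<Sum>b\<in>UNIV. \<Sum>d\<in>UNIV.
      (c * m_dn F a x y * m_dn F b x y * m_dn F d x y) * m_up F a x y * m_up F b x y * m_up F d x y)"
    using c by simp
  also have "\<dots> = c * (m_dn F 1 x y * m_up F 1 x y + m_dn F 2 x y * m_up F 2 x y) ^ 3"
    unfolding sum_2 by algebra
  finally show "c = ?s" using frame(2)[OF xy] by simp
qed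

lemma A_dn_main_scalar:
  assumes xy: "(x, y) \<in> W"
  shows "A_dn F i j k x y = main_scalar F x y * m_dn F i x y * m_dn F j x y * m_dn F k x y"
  unfolding main_scalar_eq[OF xy] by (rule cartan_frame[OF xy])

lemma A_dn_C1: "C 1 (A_dn F i j k)"
proof -
  have "A_dn F i j k = (\<lambda>x y. F x y * (1 / 2 * dy k (g i j) x y))"
    by (simp add: A_dn_def C_dn_def fun_eq_iff)
  moreover have "C 1 \<dots>"
    by (intro C_mult C_const dg_C1 C_mono[OF F_C4]) simp
  ultimately show ?thesis by (simp only:)
qed

lemma main_scalar_C1: "C 1 (main_scalar F)"
proof -
  have "C 1 (\<lambda>x y. \<Sum>a\<in>UNIV. \<Sum>b\<in>UNIV. \<Sum>c\<in>UNIV.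
      A_dn F a b c x y * m_up F a x y * m_up F b x y * m_up F c x y)"
    by (intro C_sum C_mult A_dn_C1 C_mono[OF m_up_C2]) simp_all
  then show ?thesis by (subst C_cong[of "main_scalar F", OF main_scalar_eq])
qed

lemma A_up_main_scalar:
  assumes xy: "(x, y) \<in> W"
  shows "A_up F k m i x y = main_scalar F x y * m_up F k x y * m_dn F m x y * m_dn F i x y"
  unfolding A_up_def m_up_def A_dn_main_scalar[OF xy] sum_2 by (simp only: distrib_left distrib_right mult_ac)

section \<open>Fibre derivatives of the frame and the main scalar\<close>

lemma line_diff_m_dn: "(x, y) \<in> W \<Longrightarrow> line_diff e (m_dn F i) x y"
  and line_diff_m_up: "(x, y) \<in> W \<Longrightarrow> line_diff e (m_up F i) x y"
  and line_diff_l_up: "(x, y) \<in> W \<Longrightarrow> line_diff e (l_up F i) x y"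
  and line_diff_A_dn: "(x, y) \<in> W \<Longrightarrow> line_diff e (A_dn F i j k) x y"
  and line_diff_main_scalar: "(x, y) \<in> W \<Longrightarrow> line_diff e (main_scalar F) x y"
  using line_diff_C[OF m_dn_C2] line_diff_C[OF m_up_C2] line_diff_C[OF l_up_C4]
    line_diff_C[OF A_dn_C1] line_diff_C[OF main_scalar_C1] by simp_all

lemmas line_diffs = line_diff_F line_diff_dyF line_diff_m_dn line_diff_m_up line_diff_l_up
  line_diff_A_dn line_diff_main_scalar

lemma dy_dyF:
  assumes xy: "(x, y) \<in> W"
  shows "dy j (dy i F) x y = m_dn F i x y * m_dn F j x y / F x y"
  using metric_eq[OF xy, of i j] metric_frame[OF xy, of i j] F_pos[OF xy]
  by (simp add: field_simps)

lemma dy_l_up: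
  assumes xy: "(x, y) \<in> W"
  shows "dy j (l_up F k) x y = m_up F k x y * m_dn F j x y / F x y"
proof -
  have F: "F x y \<noteq> 0" using F_pos[OF xy] by simp
  have "l_up F k = (\<lambda>x y. y $ k / F x y)"
    by (simp add: l_up_def fun_eq_iff)
  then have "dy j (l_up F k) x y
      = ((if k = j then 1 else 0) * F x y - y $ k * dy j F x y) / (F x y * F x y)"
    using F by (simp only: dy_eq_Dv Dv_divide[OF conjunct1[OF Dv_coord] line_diff_F[OF xy] F]
        Dv_coord axis_component snd_conv)
  also have "\<dots> = ((if k = j then 1 else 0) - l_up F k x y * dy j F x y) / F x y"
    using F by (simp add: l_up_def field_simps)
  also have "\<dots> = m_up F k x y * m_dn F j x y / F x y"
    by (simp only: frame(5)[OF xy, of k j, symmetric] add_diff_cancel_left')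
  finally show ?thesis .
qed

lemma dy_metric:
  assumes xy: "(x, y) \<in> W"
  shows "dy k (g i j) x y
    = 2 * main_scalar F x y * m_dn F i x y * m_dn F j x y * m_dn F k x y / F x y"
  using A_dn_main_scalar[OF xy, of i j k] F_pos[OF xy]
  by (simp add: A_dn_def C_dn_def field_simps)

text \<open>
  Jacobi's formula: \<open>\<partial>\<^sub>k ln det g = 2 g\<^sup>i\<^sup>j C\<^sub>i\<^sub>j\<^sub>k\<close>, and \<open>m\<close> is a unit covector.
\<close>

lemma dy_sqrt_det:
  assumes xy: "(x, y) \<in> W"
  shows "line_diff e r x y" "dy k r x y = main_scalar F x y * m_dn F k x y * r x y / F x y"
proof -
  note ld = line_diff_C[OF g_C2 _ xy, simplified]
  have d: "(\<lambda>x y. det (metric F x y)) = (\<lambda>x y. g 1 1 x y * g 2 2 x y - g 1 2 x y * g 2 1 x y)"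
    by (simp add: det_2)
  have line_diff_det: "line_diff e (\<lambda>x y. det (metric F x y)) x y" for e
    by (rule line_diff_C[OF det_C2 _ xy]) simp
  show "line_diff e r x y"
    using Dv_sqrt[OF line_diff_det det_pos[OF xy]] by blast
  let ?c = "2 * main_scalar F x y * m_dn F k x y / F x y"
  have "dy k (\<lambda>x y. det (metric F x y)) x y
      = dy k (g 1 1) x y * g 2 2 x y + g 1 1 x y * dy k (g 2 2) x y
        - (dy k (g 1 2) x y * g 2 1 x y + g 1 2 x y * dy k (g 2 1) x y)"
    unfolding d dy_eq_Dv by (simp add: Dv_rules ld)
  also have "\<dots> = ?c * det (metric F x y)"
    unfolding det_2 dy_metric[OF xy] metric_frame[OF xy] using F_pos[OF xy]
    by (simp add: field_simps)
  finally have "dy k r x y = ?c * det (metric F x y) / (2 * r x y)"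
    using Dv_sqrt[OF line_diff_det det_pos[OF xy], of "ver k"] by (simp only: dy_eq_Dv)
  also have "\<dots> = main_scalar F x y * m_dn F k x y * r x y / F x y"
    using det_pos[OF xy] real_sqrt_mult_self[of "det (metric F x y)"] F_pos[OF xy]
    by (simp add: field_simps)
  finally show "dy k r x y = main_scalar F x y * m_dn F k x y * r x y / F x y" .
qed

text \<open>
  \<open>m\<^sub>i\<close> is the density times \<open>l\<^sup>k\<close> rotated by a right angle: the density contributes \<open>I m\<^sub>i m\<^sub>j\<close>, and the
  rotated \<open>l\<^sup>k\<close> contributes \<open>- l\<^sub>i m\<^sub>j\<close>.
\<close>

lemma dy_m_dn:
  assumes xy: "(x, y) \<in> W"
  shows "dy j (m_dn F i) x y
    = (main_scalar F x y * m_dn F i x y - dy i F x y) * m_dn F j x y / F x y"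
proof -
  have p: "r x y > 0" "F x y > 0" "F x y \<noteq> 0" using det_pos[OF xy] F_pos[OF xy] by simp_all
  have M: "r x y * m_up F 2 x y = dy 1 F x y" "r x y * m_up F 1 x y = - dy 2 F x y"
    using p m_up_eq[OF xy] by simp_all
  have lm: "m_dn F 1 = (\<lambda>x y. - (r x y * l_up F 2 x y))" "m_dn F 2 = (\<lambda>x y. r x y * l_up F 1 x y)"
    by (simp_all add: m_dn_eq l_up_def)
  have d: "dy j (\<lambda>x y. r x y * l_up F k x y) x y
      = dy j r x y * l_up F k x y + r x y * dy j (l_up F k) x y"
     "line_diff (ver j) (\<lambda>x y. r x y * l_up F k x y) x y" for k
    using Dv_mult[OF dy_sqrt_det(1)[OF xy] line_diff_l_up[OF xy]] by (simp_all only: dy_eq_Dv)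
  have d': "dy j (\<lambda>x y. - (r x y * l_up F 2 x y)) x y = - dy j (\<lambda>x y. r x y * l_up F 2 x y) x y"
    using Dv_minus[OF d(2)] by (simp only: dy_eq_Dv)
  have "dy j (m_dn F 1) x y = (main_scalar F x y * m_dn F 1 x y - dy 1 F x y) * m_dn F j x y / F x y"
    unfolding lm(1) d' d(1) dy_sqrt_det(2)[OF xy] dy_l_up[OF xy] M(1)[symmetric]
    using p by (simp add: field_simps)
  moreover have "dy j (m_dn F 2) x y = (main_scalar F x y * m_dn F 2 x y - dy 2 F x y) * m_dn F j x y / F x y"
    unfolding lm(2) d(1) dy_sqrt_det(2)[OF xy] dy_l_up[OF xy]
    using p M(2) by (simp add: field_simps)
  ultimately show ?thesis
    using exhaust_2[of i] by auto
qed

lemma dy_m_up: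
  assumes xy: "(x, y) \<in> W"
  shows "dy j (m_up F i) x y
    = - (l_up F i x y + main_scalar F x y * m_up F i x y) * m_dn F j x y / F x y"
proof -
  have p: "r x y > 0" "F x y > 0" "r x y \<noteq> 0" using det_pos[OF xy] F_pos[OF xy] by simp_all
  have m: "m_dn F 1 x y = - (r x y * l_up F 2 x y)" "m_dn F 2 x y = r x y * l_up F 1 x y"
    by (simp_all add: m_dn_eq l_up_def)
  have d: "dy j (\<lambda>x y. dy k F x y / r x y) x y
      = (dy j (dy k F) x y * r x y - dy k F x y * dy j r x y) / (r x y * r x y)"
    "line_diff (ver j) (\<lambda>x y. dy k F x y / r x y) x y" for k
    using Dv_divide[OF line_diff_dyF[OF xy] dy_sqrt_det(1)[OF xy] p(3)] by (simp_all only: dy_eq_Dv)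
  have d1: "dy j (\<lambda>x y. dy k F x y / r x y) x y
      = (m_dn F k x y / r x y - main_scalar F x y * (dy k F x y / r x y)) * m_dn F j x y / F x y" for k
    unfolding d(1) dy_dyF[OF xy] dy_sqrt_det(2)[OF xy] using p by (simp add: divide_simps) (simp add: algebra_simps)
  have "dy j (m_up F 1) x y = dy j (\<lambda>x y. - (dy 2 F x y / r x y)) x y"
    "dy j (m_up F 2) x y = dy j (\<lambda>x y. dy 1 F x y / r x y) x y"
    unfolding dy_eq_Dv by (rule Dv_cong[OF _ xy], simp add: m_up_eq flip: dy_eq_Dv)+
  moreover have "dy j (\<lambda>x y. - (dy 2 F x y / r x y)) x y = - dy j (\<lambda>x y. dy 2 F x y / r x y) x y"
    using Dv_minus[OF d(2)] by (simp only: dy_eq_Dv)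
  ultimately show ?thesis
    using exhaust_2[of i] p by (auto simp: d1 m m_up_eq[OF xy] field_simps simp del: real_sqrt_gt_0_iff)
qed

text \<open>
  The derivative along the Euler field vanishes on \<open>m\<^sup>i\<close> because \<open>m\<^sub>j y\<^sup>j = 0\<close>, and on \<open>A\<^sub>i\<^sub>j\<^sub>k\<close> because \<open>F\<close> and
  \<open>C\<^sub>i\<^sub>j\<^sub>k\<close> have opposite degrees. So \<open>I\<close>, a contraction of these, is constant along rays.
\<close>

lemma main_scalar_radial:
  assumes xy: "(x, y) \<in> W"
  shows "l_up F 1 x y * dy 1 (main_scalar F) x y + l_up F 2 x y * dy 2 (main_scalar F) x y = 0"
proof -
  have p: "F x y > 0" using F_pos[OF xy] .
  have my: "y $ 1 * m_dn F 1 x y + y $ 2 * m_dn F 2 x y = 0"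
    by (simp add: m_dn_eq)
  have M: "Dv (0, y) (m_up F i) x y = 0" for i
  proof -
    have "Dv (0, y) (m_up F i) x y = - (l_up F i x y + main_scalar F x y * m_up F i x y) / F x y
        * (y $ 1 * m_dn F 1 x y + y $ 2 * m_dn F 2 x y)"
      unfolding Dv_fibre_direction[OF m_up_C2[of i, unfolded numeral_2_eq_2] xy] dy_m_up[OF xy]
      using p by (simp add: field_simps)
    then show ?thesis by (simp add: my)
  qed
  have A: "Dv (0, y) (A_dn F i j k) x y = 0" for i j k
  proof -
    have "A_dn F i j k = (\<lambda>x y. F x y * (1 / 2 * dy k (g i j) x y))"
      by (simp add: A_dn_def C_dn_def fun_eq_iff)
    then have "Dv (0, y) (A_dn F i j k) x y
        = Dv (0, y) F x y * (1 / 2 * dy k (g i j) x y) + F x y * (1 / 2 * Dv (0, y) (dy k (g i j)) x y)"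
      by (simp add: Dv_rules line_diff_dg[OF xy] line_diff_F[OF xy])
    moreover have "Dv (0, y) F x y = F x y"
      using Dv_fibre_direction[of 3 F x y y] F_C4 xy euler_F[OF xy] by (simp del: Ck_on.simps)
    moreover have "Dv (0, y) (dy k (g i j)) x y = - dy k (g i j) x y"
      using Dv_fibre_direction[of 0 "dy k (g i j)" x y y] dg_C1[of k i j] xy euler_dmetric[OF xy, of k i j]
      by (simp add: mult.commute del: Ck_on.simps)
    ultimately show ?thesis by simp
  qed
  have "Dv (0, y) (main_scalar F) x y = Dv (0, y) (\<lambda>x y. \<Sum>a\<in>UNIV. \<Sum>b\<in>UNIV. \<Sum>c\<in>UNIV.
      A_dn F a b c x y * m_up F a x y * m_up F b x y * m_up F c x y) x y"
    by (rule Dv_cong[OF _ xy]) (rule main_scalar_eq)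
  also have "\<dots> = 0"
    by (simp add: sum_2 Dv_rules line_diffs[OF xy] M A)
  finally have "y $ 1 * dy 1 (main_scalar F) x y + y $ 2 * dy 2 (main_scalar F) x y = 0"
    using Dv_fibre_direction[of 0 "main_scalar F" x y y] main_scalar_C1 xy by (simp del: Ck_on.simps)
  then show ?thesis
    by (simp add: l_up_def flip: add_divide_distrib)
qed

lemma dy_main_scalar:
  assumes xy: "(x, y) \<in> W"
  shows "dy j (main_scalar F) x y
    = (m_up F 1 x y * dy 1 (main_scalar F) x y + m_up F 2 x y * dy 2 (main_scalar F) x y) * m_dn F j x y"
  using frame_kernel[OF xy, of "\<lambda>k. dy k (main_scalar F) x y" j] main_scalar_radial[OF xy] F_pos[OF xy]
  by (simp add: l_up_def field_simps)

end

section \<open>The connection coefficients defined by the angle function\<close>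

locale finsler_angle = finsler_region +
  fixes \<theta> :: tfun
  assumes angle: "angle_function_on W F \<theta>"
begin

lemma theta_C3: "C 3 \<theta>"
  using angle by (simp add: angle_function_on_def)

lemma dy_theta: "(x, y) \<in> W \<Longrightarrow> dy i \<theta> x y = m_dn F i x y / F x y"
  using angle F_pos[of x y] by (auto simp: angle_function_on_def field_simps)

lemma dx_dy_commute: "C 2 f \<Longrightarrow> (x, y) \<in> W \<Longrightarrow> dy i (dx n f) x y = dx n (dy i f) x y"
  using Dv_commute[of 0 f x y "ver i" "hor n"]
  by (simp add: dx_eq_Dv dy_eq_Dv hor_ver_Basis numeral_2_eq_2 del: Ck_on.simps)

lemma line_diff_dx: "C 2 f \<Longrightarrow> (x, y) \<in> W \<Longrightarrow> line_diff e (dx n f) x y"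
  using line_diff_C[OF C_Dv[of 1 f "hor n"]]
  by (simp add: dx_eq_Dv hor_ver_Basis numeral_2_eq_2 del: Ck_on.simps)

lemma dy_dx_F:
  assumes xy: "(x, y) \<in> W"
  shows "dy i (dx n F) x y = dx n (dy i F) x y"
  by (rule dx_dy_commute[OF C_mono[OF F_C4] xy]) simp

text \<open>
  \<open>dx n\<close> and \<open>dy i\<close> commute on \<open>\<theta>\<close>, whose fibre derivative is \<open>m\<^sub>i / F\<close>: the derivatives of the angle
  function become base derivatives of the frame. The next lemmas treat \<open>l\<^sub>i\<close> and \<open>m\<^sub>i\<close> in the same way.
\<close>

lemma dy_dx_theta:
  assumes xy: "(x, y) \<in> W"
  shows "dy i (dx n \<theta>) x y
    = (dx n (m_dn F i) x y - m_dn F i x y * dx n F x y / F x y) / F x y"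
proof -
  have F: "F x y \<noteq> 0" using F_pos[OF xy] by simp
  have "dy i (dx n \<theta>) x y = dx n (dy i \<theta>) x y"
    by (rule dx_dy_commute[OF C_mono[OF theta_C3] xy]) simp
  also have "\<dots> = dx n (\<lambda>x y. m_dn F i x y / F x y) x y"
    unfolding dx_eq_Dv by (rule Dv_cong[OF _ xy]) (rule dy_theta)
  also have "\<dots> = (dx n (m_dn F i) x y * F x y - m_dn F i x y * dx n F x y) / (F x y * F x y)"
    using Dv_divide[OF line_diff_m_dn[OF xy] line_diff_F[OF xy] F] by (simp add: dx_eq_Dv)
  finally show ?thesis using F by (simp add: field_simps)
qed

lemma dy_dx_l:
  assumes xy: "(x, y) \<in> W"
  shows "dy m (dx n (dy i F)) x y
    = (dx n (m_dn F i) x y * m_dn F m x y + m_dn F i x y * dx n (m_dn F m) x y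
        - m_dn F i x y * m_dn F m x y * dx n F x y / F x y) / F x y"
proof -
  have F: "F x y \<noteq> 0" using F_pos[OF xy] by simp
  have "dy m (dx n (dy i F)) x y = dx n (dy m (dy i F)) x y"
    by (rule dx_dy_commute[OF C_mono[OF dyF_C3] xy]) simp
  also have "\<dots> = dx n (\<lambda>x y. m_dn F i x y * m_dn F m x y / F x y) x y"
    unfolding dx_eq_Dv by (rule Dv_cong[OF _ xy]) (rule dy_dyF)
  also have "\<dots> = ((dx n (m_dn F i) x y * m_dn F m x y + m_dn F i x y * dx n (m_dn F m) x y) * F x y
      - m_dn F i x y * m_dn F m x y * dx n F x y) / (F x y * F x y)"
    by (simp add: dx_eq_Dv Dv_rules line_diffs[OF xy] F)
  finally show ?thesis using F by (simp add: field_simps)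
qed

lemma dy_dx_m:
  assumes xy: "(x, y) \<in> W"
  shows "dy m (dx n (m_dn F i)) x y
    = ((dx n (main_scalar F) x y * m_dn F i x y + main_scalar F x y * dx n (m_dn F i) x y
          - dx n (dy i F) x y) * m_dn F m x y
        + (main_scalar F x y * m_dn F i x y - dy i F x y)
          * (dx n (m_dn F m) x y - m_dn F m x y * dx n F x y / F x y)) / F x y"
proof -
  have F: "F x y \<noteq> 0" using F_pos[OF xy] by simp
  have "dy m (dx n (m_dn F i)) x y = dx n (dy m (m_dn F i)) x y"
    by (rule dx_dy_commute[OF m_dn_C2 xy])
  also have "\<dots> = dx n (\<lambda>x y. (main_scalar F x y * m_dn F i x y - dy i F x y) * m_dn F m x y / F x y) x y"
    unfolding dx_eq_Dv by (rule Dv_cong[OF _ xy]) (rule dy_m_dn)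
  also have "\<dots> = (((dx n (main_scalar F) x y * m_dn F i x y + main_scalar F x y * dx n (m_dn F i) x y
          - dx n (dy i F) x y) * m_dn F m x y
        + (main_scalar F x y * m_dn F i x y - dy i F x y) * dx n (m_dn F m) x y) * F x y
      - (main_scalar F x y * m_dn F i x y - dy i F x y) * m_dn F m x y * dx n F x y) / (F x y * F x y)"
    by (simp add: dx_eq_Dv Dv_rules line_diffs[OF xy] F)
  finally show ?thesis using F by (simp add: field_simps)
qed

lemma line_diff_dxs:
  assumes xy: "(x, y) \<in> W"
  shows "line_diff e (dx n F) x y" "line_diff e (dx n (dy i F)) x y"
    "line_diff e (dx n (m_dn F i)) x y" "line_diff e (dx n \<theta>) x y"
  using line_diff_dx[OF C_mono[OF F_C4] xy] line_diff_dx[OF C_mono[OF dyF_C3] xy]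
    line_diff_dx[OF m_dn_C2 xy] line_diff_dx[OF C_mono[OF theta_C3] xy] by simp_all

text \<open>
  The two terms with \<open>\<partial>F/\<partial>x\<^sup>n\<close>, one from \<open>\<partial>\<^sub>i l\<^sup>k\<close> and one from \<open>\<partial>\<^sub>i (\<partial>\<theta>/\<partial>x\<^sup>n)\<close>, cancel.
\<close>

lemma dy_N:
  assumes xy: "(x, y) \<in> W"
  shows "dy i (N_coeff F \<theta> \<kappa> k n) x y =
    - l_up F k x y * dx n (dy i F) x y - m_up F k x y * dx n (m_dn F i) x y
    + (dx n \<theta> x y - \<kappa> n x) * (l_up F k x y * m_dn F i x y - m_up F k x y * dy i F x y
        + main_scalar F x y * (m_up F k x y * m_dn F i x y))"
proof -
  have F: "F x y \<noteq> 0" using F_pos[OF xy] by simp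
  have *: "dy i (N_coeff F \<theta> \<kappa> k n) x y
      = - (dy i (l_up F k) x y * dx n F x y + l_up F k x y * dy i (dx n F) x y)
        - ((dy i F x y * m_up F k x y + F x y * dy i (m_up F k) x y) * (dx n \<theta> x y - \<kappa> n x)
          + F x y * m_up F k x y * dy i (dx n \<theta>) x y)"
    unfolding N_coeff_def[abs_def]
    by (simp add: dy_eq_Dv[of i] Dv_rules line_diffs[OF xy] line_diff_dxs[OF xy])
  show ?thesis
    unfolding * dy_l_up[OF xy] dy_dx_F[OF xy] dy_m_up[OF xy] dy_dx_theta[OF xy]
    using F by (simp add: field_simps)
qed

text \<open>
  The bracket \<open>l\<^sup>k m\<^sub>i - m\<^sup>k l\<^sub>i + I m\<^sup>k m\<^sub>i\<close> is constant along the fibre up to the derivative of \<open>I\<close>, and the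
  derivative of its factor \<open>\<partial>\<theta>/\<partial>x\<^sup>n - k\<^sub>n\<close> removes the base derivatives of \<open>l\<close> and \<open>m\<close>.
\<close>

lemma dy_dy_N:
  assumes xy: "(x, y) \<in> W"
  shows "dy m (dy i (N_coeff F \<theta> \<kappa> k n)) x y =
    - m_up F k x y * m_dn F m x y * m_dn F i x y / F x y * dx n (main_scalar F) x y
    + (dx n \<theta> x y - \<kappa> n x) * dy m (main_scalar F) x y * m_up F k x y * m_dn F i x y"
proof -
  have F: "F x y \<noteq> 0" using F_pos[OF xy] by simp
  have "dy m (dy i (N_coeff F \<theta> \<kappa> k n)) x y = dy m (\<lambda>x y.
    - l_up F k x y * dx n (dy i F) x y - m_up F k x y * dx n (m_dn F i) x y
    + (dx n \<theta> x y - \<kappa> n x) * (l_up F k x y * m_dn F i x y - m_up F k x y * dy i F x y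
        + main_scalar F x y * (m_up F k x y * m_dn F i x y))) x y"
    unfolding dy_eq_Dv by (rule Dv_cong[OF _ xy]) (use dy_N in \<open>simp add: dy_eq_Dv\<close>)
  also have "\<dots> =
    - (dy m (l_up F k) x y * dx n (dy i F) x y + l_up F k x y * dy m (dx n (dy i F)) x y)
    - (dy m (m_up F k) x y * dx n (m_dn F i) x y + m_up F k x y * dy m (dx n (m_dn F i)) x y)
    + (dy m (dx n \<theta>) x y * (l_up F k x y * m_dn F i x y - m_up F k x y * dy i F x y
        + main_scalar F x y * (m_up F k x y * m_dn F i x y))
      + (dx n \<theta> x y - \<kappa> n x) * (
          dy m (l_up F k) x y * m_dn F i x y + l_up F k x y * dy m (m_dn F i) x y
          - (dy m (m_up F k) x y * dy i F x y + m_up F k x y * dy m (dy i F) x y)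
          + (dy m (main_scalar F) x y * (m_up F k x y * m_dn F i x y)
            + main_scalar F x y * (dy m (m_up F k) x y * m_dn F i x y + m_up F k x y * dy m (m_dn F i) x y))))"
    by (simp add: dy_eq_Dv[of m] Dv_rules line_diffs[OF xy] line_diff_dxs[OF xy])
  also have "\<dots> = - m_up F k x y * m_dn F m x y * m_dn F i x y / F x y * dx n (main_scalar F) x y
    + (dx n \<theta> x y - \<kappa> n x) * dy m (main_scalar F) x y * m_up F k x y * m_dn F i x y"
    unfolding dy_l_up[OF xy] dy_dx_l[OF xy] dy_dx_m[OF xy] dy_m_up[OF xy] dy_dx_theta[OF xy]
      dy_m_dn[OF xy] dy_dyF[OF xy]
    using F by (simp add: divide_simps) (simp add: algebra_simps)
  finally show ?thesis .
qed

text \<open>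
  The part of \<open>N\<^sup>k\<^sub>n\<close> along \<open>l\<^sup>k\<close> does not contribute, because \<open>I\<close> is constant along rays.
\<close>

lemma d_op_main_scalar:
  assumes xy: "(x, y) \<in> W"
  shows "d_op F \<theta> \<kappa> n (main_scalar F) x y = dx n (main_scalar F) x y
    - F x y * (dx n \<theta> x y - \<kappa> n x)
      * (m_up F 1 x y * dy 1 (main_scalar F) x y + m_up F 2 x y * dy 2 (main_scalar F) x y)"
proof -
  let ?L = "l_up F 1 x y * dy 1 (main_scalar F) x y + l_up F 2 x y * dy 2 (main_scalar F) x y"
  have "d_op F \<theta> \<kappa> n (main_scalar F) x y = dx n (main_scalar F) x y - dx n F x y * ?L
    - F x y * (dx n \<theta> x y - \<kappa> n x)
      * (m_up F 1 x y * dy 1 (main_scalar F) x y + m_up F 2 x y * dy 2 (main_scalar F) x y)"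
    by (simp add: d_op_def sum_2 N_coeff_def algebra_simps)
  then show ?thesis by (simp add: main_scalar_radial[OF xy])
qed

lemma N_coeff2_eq:
  assumes xy: "(x, y) \<in> W"
  shows "N_coeff2 F \<theta> \<kappa> k n m i x y =
    - (1 / F x y) * m_up F k x y * m_dn F m x y * m_dn F i x y * d_op F \<theta> \<kappa> n (main_scalar F) x y"
proof -
  let ?D = "m_up F 1 x y * dy 1 (main_scalar F) x y + m_up F 2 x y * dy 2 (main_scalar F) x y"
  have F: "F x y \<noteq> 0" using F_pos[OF xy] by simp
  show ?thesis
    unfolding N_coeff2_def dy_dy_N[OF xy] d_op_main_scalar[OF xy] dy_main_scalar[OF xy, of m]
    using F by (simp add: field_simps)
qed

lemma d_op_ln_abs_main_scalar:
  assumes xy: "(x, y) \<in> W" and I: "main_scalar F x y \<noteq> 0"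
  shows "d_op F \<theta> \<kappa> n (\<lambda>x y. ln \<bar>main_scalar F x y\<bar>) x y
    = d_op F \<theta> \<kappa> n (main_scalar F) x y / main_scalar F x y"
  by (simp add: d_op_def dx_eq_Dv dy_eq_Dv sum_2 add_divide_distrib
      Dv_ln_abs[OF line_diff_main_scalar[OF xy] I])

end

theorem mainTheorem3:
  fixes U :: "(real^2) set" and W :: "((real^2) \<times> (real^2)) set"
    and F \<theta> :: "real^2 \<Rightarrow> real^2 \<Rightarrow> real" and \<kappa> :: "2 \<Rightarrow> real^2 \<Rightarrow> real"
  assumes "open U"
    and "conic_region U W"
    and "finsler_metric_on W F"
    and "angle_function_on W F \<theta>"
    and "smooth_covector_field_on U \<kappa>"
  shows "(\<forall>(x, y)\<in>W. \<forall>k n m i.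
            N_coeff2 F \<theta> \<kappa> k n m i x y =
              - (1 / F x y) * m_up F k x y * m_dn F m x y * m_dn F i x y
                * d_op F \<theta> \<kappa> n (main_scalar F) x y) \<and>
         (\<forall>(x, y)\<in>W. main_scalar F x y \<noteq> 0 \<longrightarrow> (\<forall>k n m i.
            N_coeff2 F \<theta> \<kappa> k n m i x y =
              - (1 / F x y) * A_up F k m i x y
                * d_op F \<theta> \<kappa> n (\<lambda>x y. ln \<bar>main_scalar F x y\<bar>) x y))"
proof -
  interpret finsler_angle U W F \<theta>
    using assms by unfold_locales
  show ?thesis
    by (auto simp: N_coeff2_eq A_up_main_scalar d_op_ln_abs_main_scalar)
qed

end
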